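(* Let $n\ge 1$. For each $\mathcal{L}_{\Diamond\exists}$-formula $\varphi$: (1) $\varphi\in\mathbf{M}^+\mathbf{Grz}[n]\implies\varphi^+\in\mathbf{MGL}[n]$. (2) $\varphi\in\mathbf{M}^+\mathbf{GrzB}[n]\implies\varphi^+\in\mathbf{MGLB}[n]$. (3) $\varphi^+\in\mathbf{MGL}[n]\implies\varphi\in\mathbf{M}^+\mathbf{Grz}[n]$. (4) $\varphi^+\in\mathbf{MGLB}[n]\implies\varphi\in\mathbf{M}^+\mathbf{GrzB}[n]$.
   Context: $\mathcal{L}_{\Diamond\exists}$ is the propositional language with two modalities $\Diamond,\exists$, with $\Box=\neg\Diamond\neg$ and $\forall=\neg\exists\neg$. $\mathbf{GL}=\mathbf{K}+\Box(\Box p\to p)\to\Box p$ and $\mathbf{Grz}=\mathbf{K}+\Box(\Box(p\to\Box p)\to p)\to p$ (in modality $\Diamond$), and $\mathbf{S5}$ is formulated in modality $\exists$. For a unimodal logic $\mathbf{L}$, the fusion $\mathbf{L}\otimes\mathbf{S5}$ is the least set of $\mathcal{L}_{\Diamond\exists}$-formulae containing the theorems of $\mathbf{L}$ and of $\mathbf{S5}$ and closed under Modus Ponens, Substitution, $\Box$-necessitation, and $\forall$-necessitation; "$+$" denotes the least extension containing the given formulae and closed under the same rules. Put $$\mathbf{ML}=(\mathbf{L}\otimes\mathbf{S5})+(\exists\Diamond p\to\Diamond\exists p),\qquad \mathbf{MLB}=\mathbf{ML}+(\Diamond\exists p\to\exists\Diamond p),$$ (giving $\mathbf{MGL},\mathbf{MGLB},\mathbf{MGrz},\mathbf{MGrzB}$).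 With $\mathrm{Cas}=\Box\forall(\Box(\Box p\to\Box\forall p)\to\Box\forall p)\to\Box\forall p$, put $\mathbf{M}^+\mathbf{Grz}=\mathbf{MGrz}+\mathrm{Cas}$ and $\mathbf{M}^+\mathbf{GrzB}=\mathbf{MGrzB}+\mathrm{Cas}$. The finite depth formulae are $bd_1=\Diamond\Box p_1\to p_1$ and $bd_n=\Diamond(\Box p_n\wedge\neg bd_{n-1})\to p_n$ for $n\ge2$; for any logic $\mathbf{M}$, $\mathbf{M}[n]=\mathbf{M}+bd_n$. The translation $\varphi\mapsto\varphi^+$ replaces each occurrence of $\Box$ by $\Box^+$, where $\Box^+\psi=\psi\wedge\Box\psi$; equivalently, it fixes propositional letters, commutes with Boolean connectives and $\exists$, and $(\Diamond\psi)^+=\psi^+\vee\Diamond\psi^+$. *)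

theory Defs
  imports Main
begin

section \<open>Formulas\<close>

text \<open>
  One syntax for all the languages involved: the parameter \<^typ>\<open>'m\<close> is the type of indices
  of the modalities. The possibility operators are primitive, the necessity operators are
  defined from them.
\<close>

datatype 'm form =
    Var nat
  | Bot
  | Imp "'m form" "'m form"  (infixr "\<^bold>\<rightarrow>" 55)
  | Dia 'm "'m form"

abbreviation Neg :: "'m form \<Rightarrow> 'm form"  ("\<^bold>\<not> _" [80] 80) where
  "\<^bold>\<not> \<phi> \<equiv> \<phi> \<^bold>\<rightarrow> Bot"

abbreviation Or :: "'m form \<Rightarrow> 'm form \<Rightarrow> 'm form"  (infixr "\<^bold>\<or>" 60) where
  "\<phi> \<^bold>\<or> \<psi> \<equiv> \<^bold>\<not> \<phi> \<^bold>\<rightarrow> \<psi>"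

abbreviation And :: "'m form \<Rightarrow> 'm form \<Rightarrow> 'm form"  (infixr "\<^bold>\<and>" 65) where
  "\<phi> \<^bold>\<and> \<psi> \<equiv> \<^bold>\<not> (\<phi> \<^bold>\<rightarrow> \<^bold>\<not> \<psi>)"

abbreviation Iff :: "'m form \<Rightarrow> 'm form \<Rightarrow> 'm form"  (infix "\<^bold>\<leftrightarrow>" 50) where
  "\<phi> \<^bold>\<leftrightarrow> \<psi> \<equiv> (\<phi> \<^bold>\<rightarrow> \<psi>) \<^bold>\<and> (\<psi> \<^bold>\<rightarrow> \<phi>)"

abbreviation Box :: "'m \<Rightarrow> 'm form \<Rightarrow> 'm form" where
  "Box m \<phi> \<equiv> \<^bold>\<not> Dia m (\<^bold>\<not> \<phi>)"

primrec subst :: "(nat \<Rightarrow> 'm form) \<Rightarrow> 'm form \<Rightarrow> 'm form" where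
  "subst \<sigma> (Var i) = \<sigma> i"
| "subst \<sigma> Bot = Bot"
| "subst \<sigma> (\<phi> \<^bold>\<rightarrow> \<psi>) = subst \<sigma> \<phi> \<^bold>\<rightarrow> subst \<sigma> \<psi>"
| "subst \<sigma> (Dia m \<phi>) = Dia m (subst \<sigma> \<phi>)"

text \<open>Propositional truth, with formulas of the form \<^term>\<open>Dia m \<phi>\<close> treated as further atoms.\<close>

primrec ptrue :: "('m form \<Rightarrow> bool) \<Rightarrow> 'm form \<Rightarrow> bool" where
  "ptrue v (Var i) = v (Var i)"
| "ptrue v Bot = False"
| "ptrue v (\<phi> \<^bold>\<rightarrow> \<psi>) = (ptrue v \<phi> \<longrightarrow> ptrue v \<psi>)"
| "ptrue v (Dia m \<phi>) = v (Dia m \<phi>)"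

definition tautologies :: "'m form set" where
  "tautologies = {\<phi>. \<forall>v. ptrue v \<phi>}"

section \<open>Logics\<close>

text \<open>The least set containing \<open>A\<close> and closed under the rules.\<close>

inductive_set logic_closure :: "'m form set \<Rightarrow> 'm form set" for A :: "'m form set" where
  base: "\<phi> \<in> A \<Longrightarrow> \<phi> \<in> logic_closure A"
| modus_ponens: "\<phi> \<^bold>\<rightarrow> \<psi> \<in> logic_closure A \<Longrightarrow> \<phi> \<in> logic_closure A \<Longrightarrow> \<psi> \<in> logic_closure A"
| substitution: "\<phi> \<in> logic_closure A \<Longrightarrow> subst \<sigma> \<phi> \<in> logic_closure A"
| necessitation: "\<phi> \<in> logic_closure A \<Longrightarrow> Box m \<phi> \<in> logic_closure A"

definition extension :: "'m form set \<Rightarrow> 'm form \<Rightarrow> 'm form set"  (infixl "\<^bold>+" 65) where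
  "M \<^bold>+ \<alpha> = logic_closure (M \<union> {\<alpha>})"

subsection \<open>Unimodal logics\<close>

abbreviation udia :: "unit form \<Rightarrow> unit form"  ("\<diamond> _" [80] 80) where
  "\<diamond> \<phi> \<equiv> Dia () \<phi>"

abbreviation ubox :: "unit form \<Rightarrow> unit form"  ("\<box> _" [80] 80) where
  "\<box> \<phi> \<equiv> Box () \<phi>"

text \<open>
  The last axiom is needed because \<open>\<diamond>\<close> is the primitive operator: without it, \<open>\<diamond>\<close> would not
  respect provable equivalence.
\<close>

definition K :: "unit form set" where
  "K = logic_closure (tautologies \<union>
     {\<box> (Var 0 \<^bold>\<rightarrow> Var 1) \<^bold>\<rightarrow> \<box> Var 0 \<^bold>\<rightarrow> \<box> Var 1,
      \<diamond> Var 0 \<^bold>\<leftrightarrow> \<^bold>\<not> \<box> \<^bold>\<not> Var 0})"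

definition GL :: "unit form set" where
  "GL = K \<^bold>+ (\<box> (\<box> Var 0 \<^bold>\<rightarrow> Var 0) \<^bold>\<rightarrow> \<box> Var 0)"

definition Grz :: "unit form set" where
  "Grz = K \<^bold>+ (\<box> (\<box> (Var 0 \<^bold>\<rightarrow> \<box> Var 0) \<^bold>\<rightarrow> Var 0) \<^bold>\<rightarrow> Var 0)"

definition S5 :: "unit form set" where
  "S5 = K \<^bold>+ (\<box> Var 0 \<^bold>\<rightarrow> Var 0) \<^bold>+ (\<box> Var 0 \<^bold>\<rightarrow> \<box> \<box> Var 0) \<^bold>+ (Var 0 \<^bold>\<rightarrow> \<box> \<diamond> Var 0)"

subsection \<open>Monadic logics\<close>

text \<open>\<open>Mod\<close> indexes the modality \<open>\<diamond>\<close> (that of \<open>L\<close>) and \<open>Qua\<close> the modality \<open>\<exists>\<close>.\<close>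

datatype modality = Mod | Qua

type_synonym mform = "modality form"

abbreviation mdia :: "mform \<Rightarrow> mform"  ("\<^bold>\<diamond> _" [80] 80) where
  "\<^bold>\<diamond> \<phi> \<equiv> Dia Mod \<phi>"

abbreviation mbox :: "mform \<Rightarrow> mform"  ("\<^bold>\<box> _" [80] 80) where
  "\<^bold>\<box> \<phi> \<equiv> Box Mod \<phi>"

abbreviation mex :: "mform \<Rightarrow> mform"  ("\<^bold>\<exists> _" [80] 80) where
  "\<^bold>\<exists> \<phi> \<equiv> Dia Qua \<phi>"

abbreviation mall :: "mform \<Rightarrow> mform"  ("\<^bold>\<forall> _" [80] 80) where
  "\<^bold>\<forall> \<phi> \<equiv> Box Qua \<phi>"

definition fusion :: "unit form set \<Rightarrow> unit form set \<Rightarrow> mform set"  (infixl "\<^bold>\<otimes>" 70) where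
  "L \<^bold>\<otimes> L' = logic_closure (map_form (\<lambda>_. Mod) ` L \<union> map_form (\<lambda>_. Qua) ` L')"

definition monadic :: "unit form set \<Rightarrow> mform set" where
  "monadic L = (L \<^bold>\<otimes> S5) \<^bold>+ (\<^bold>\<exists> \<^bold>\<diamond> Var 0 \<^bold>\<rightarrow> \<^bold>\<diamond> \<^bold>\<exists> Var 0)"

definition monadicB :: "unit form set \<Rightarrow> mform set" where
  "monadicB L = monadic L \<^bold>+ (\<^bold>\<diamond> \<^bold>\<exists> Var 0 \<^bold>\<rightarrow> \<^bold>\<exists> \<^bold>\<diamond> Var 0)"

definition MGL :: "mform set" where
  "MGL = monadic GL"

definition MGLB :: "mform set" where
  "MGLB = monadicB GL"

definition MGrz :: "mform set" where
  "MGrz = monadic Grz"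

definition MGrzB :: "mform set" where
  "MGrzB = monadicB Grz"

definition Cas :: mform where
  "Cas = \<^bold>\<box> \<^bold>\<forall> (\<^bold>\<box> (\<^bold>\<box> Var 0 \<^bold>\<rightarrow> \<^bold>\<box> \<^bold>\<forall> Var 0) \<^bold>\<rightarrow> \<^bold>\<box> \<^bold>\<forall> Var 0) \<^bold>\<rightarrow> \<^bold>\<box> \<^bold>\<forall> Var 0"

definition MplusGrz :: "mform set" where
  "MplusGrz = MGrz \<^bold>+ Cas"

definition MplusGrzB :: "mform set" where
  "MplusGrzB = MGrzB \<^bold>+ Cas"

text \<open>The formulas \<^term>\<open>bd n\<close> are meant for \<open>n \<ge> 1\<close>; the value at \<open>0\<close> is a dummy.\<close>

fun bd :: "nat \<Rightarrow> mform" where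
  "bd 0 = Bot"
| "bd (Suc 0) = \<^bold>\<diamond> \<^bold>\<box> Var 1 \<^bold>\<rightarrow> Var 1"
| "bd (Suc (Suc n)) =
     \<^bold>\<diamond> (\<^bold>\<box> Var (Suc (Suc n)) \<^bold>\<and> \<^bold>\<not> bd (Suc n)) \<^bold>\<rightarrow> Var (Suc (Suc n))"

definition finite_depth :: "mform set \<Rightarrow> nat \<Rightarrow> mform set"  ("_\<^bold>[_\<^bold>]" [1000, 0] 1000) where
  "L\<^bold>[n\<^bold>] = L \<^bold>+ bd n"

section \<open>The translation\<close>

text \<open>
  As \<open>\<diamond>\<close> is primitive, the clause for it is the dual of replacing \<open>\<box>\<psi>\<close> by
  \<open>\<psi> \<and> \<box>\<psi>\<close>.
\<close>

fun plus_translation :: "mform \<Rightarrow> mform" where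
  "plus_translation (Var i) = Var i"
| "plus_translation Bot = Bot"
| "plus_translation (\<phi> \<^bold>\<rightarrow> \<psi>) = plus_translation \<phi> \<^bold>\<rightarrow> plus_translation \<psi>"
| "plus_translation (\<^bold>\<diamond> \<phi>) = plus_translation \<phi> \<^bold>\<or> \<^bold>\<diamond> plus_translation \<phi>"
| "plus_translation (\<^bold>\<exists> \<phi>) = \<^bold>\<exists> plus_translation \<phi>"

end

theory Submission
  imports Defs "HOL-Library.Countable"
begin

text \<open>
  Both implications are read off canonical models. In the canonical frame of \<open>MGL[n]\<close> the relation
  of \<open>\<diamond>\<close> is a strict order of depth at most \<open>n\<close>; its reflexive closure validates \<open>M\<^sup>+Grz[n]\<close>, and a
  formula holds there iff its translation holds in the strict frame. Conversely, the canonical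
  frame of \<open>M\<^sup>+Grz[n]\<close> is a partial order of depth at most \<open>n\<close>, and Casari's formula excludes \<open>x < y\<close>
  for \<open>\<exists>\<close>-equivalent \<open>x, y\<close>. This is exactly what is needed for the irreflexive part to keep the
  interaction of the two relations, hence to be a frame of \<open>MGL[n]\<close>. The Barcan axiom is
  preserved by both passages. Finite depth makes the two frames canonical: maximal failing
  instances of the \<open>bd\<close> formulas serve as formulas separating a cluster from the points above it.
\<close>

section \<open>Kripke semantics\<close>

primrec sat :: "'w set \<Rightarrow> ('m \<Rightarrow> 'w \<Rightarrow> 'w \<Rightarrow> bool) \<Rightarrow> (nat \<Rightarrow> 'w \<Rightarrow> bool) \<Rightarrow> 'w \<Rightarrow> 'm form \<Rightarrow> bool" where
  "sat W R V w (Var i) = V i w"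
| "sat W R V w Bot = False"
| "sat W R V w (\<phi> \<^bold>\<rightarrow> \<psi>) = (sat W R V w \<phi> \<longrightarrow> sat W R V w \<psi>)"
| "sat W R V w (Dia m \<phi>) = (\<exists>v\<in>W. R m w v \<and> sat W R V v \<phi>)"

lemma sat_Box: "sat W R V w (Box m \<phi>) \<longleftrightarrow> (\<forall>v\<in>W. R m w v \<longrightarrow> sat W R V v \<phi>)"
  by auto

definition frame_logic :: "'w set \<Rightarrow> ('m \<Rightarrow> 'w \<Rightarrow> 'w \<Rightarrow> bool) \<Rightarrow> 'm form set" where
  "frame_logic W R = {\<phi>. \<forall>V. \<forall>w\<in>W. sat W R V w \<phi>}"

lemma sat_subst: "sat W R V w (subst \<sigma> \<phi>) = sat W R (\<lambda>i v. sat W R V v (\<sigma> i)) w \<phi>"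
  by (induction \<phi> arbitrary: w) auto

lemma sat_map_form: "sat W R V w (map_form f \<phi>) = sat W (\<lambda>m. R (f m)) V w \<phi>"
  by (induction \<phi> arbitrary: w) auto

lemma ptrue_sat: "ptrue (sat W R V w) \<phi> = sat W R V w \<phi>"
  by (induction \<phi>) auto

lemma sat_cong:
  assumes "\<And>m x y. x \<in> W \<Longrightarrow> y \<in> W \<Longrightarrow> R m x y = R' m x y" and "w \<in> W"
  shows "sat W R V w \<phi> = sat W R' V w \<phi>"
  using assms(2) by (induction \<phi> arbitrary: w) (auto simp: assms(1))

lemma logic_closure_le_frame_logic:
  assumes "A \<subseteq> frame_logic W R"
  shows "logic_closure A \<subseteq> frame_logic W R"
proof
  fix \<phi> assume "\<phi> \<in> logic_closure A"
  then show "\<phi> \<in> frame_logic W R"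
    by (induction rule: logic_closure.induct)
      (use assms in \<open>auto simp: frame_logic_def sat_subst\<close>)
qed

lemma extension_le_frame_logic:
  "M \<subseteq> frame_logic W R \<Longrightarrow> \<alpha> \<in> frame_logic W R \<Longrightarrow> M \<^bold>+ \<alpha> \<subseteq> frame_logic W R"
  by (simp add: extension_def logic_closure_le_frame_logic)

lemma K_le_frame_logic: "K \<subseteq> frame_logic W R"
proof -
  have "tautologies \<subseteq> frame_logic W R"
    by (auto simp: tautologies_def frame_logic_def simp flip: ptrue_sat)
  then show ?thesis
    unfolding K_def by (intro logic_closure_le_frame_logic) (auto simp: frame_logic_def)
qed

lemma fusion_le_frame_logic:
  assumes "L \<subseteq> frame_logic W (\<lambda>_. R Mod)" and "L' \<subseteq> frame_logic W (\<lambda>_. R Qua)"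
  shows "L \<^bold>\<otimes> L' \<subseteq> frame_logic W R"
  unfolding fusion_def using assms
  by (intro logic_closure_le_frame_logic) (auto simp: frame_logic_def sat_map_form)

section \<open>Frames of finite depth\<close>

text \<open>Counts steps, not points: \<open>\<not> deep W R n x\<close> leaves room for chains of
  at most n points starting at x. A loop is deep for every k, so bounded depth forces
  irreflexivity.\<close>

primrec deep :: "'w set \<Rightarrow> ('w \<Rightarrow> 'w \<Rightarrow> bool) \<Rightarrow> nat \<Rightarrow> 'w \<Rightarrow> bool" where
  "deep W R 0 x = True"
| "deep W R (Suc k) x = (\<exists>y\<in>W. R x y \<and> deep W R k y)"

lemma deep_SucD: "deep W R (Suc k) x \<Longrightarrow> deep W R k x"
  by (induction k arbitrary: x) auto

text \<open>Bounded depth stands in for well-foundedness: the successors of a point that is not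
  \<open>Suc k\<close> deep are not \<open>k\<close> deep, so the bound drops along R.\<close>

lemma finite_depth_induct [consumes 2, case_names step]:
  assumes depth: "\<And>x. x \<in> W \<Longrightarrow> \<not> deep W R n x" and "x \<in> W"
    and step: "\<And>x. x \<in> W \<Longrightarrow> (\<And>y. y \<in> W \<Longrightarrow> R x y \<Longrightarrow> P y) \<Longrightarrow> P x"
  shows "P x"
proof -
  have *: "\<And>x. x \<in> W \<Longrightarrow> \<not> deep W R k x \<Longrightarrow> P x" for k
  proof (induction k)
    case (Suc k)
    then show ?case
      using step[of x] by auto
  qed simp
  show ?thesis
    by (rule *[OF \<open>x \<in> W\<close> depth[OF \<open>x \<in> W\<close>]])
qed

section \<open>Soundness on frames of finite depth, for the strict and the reflexive reading of
  \<diamond>\<close>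

locale monadic_frame =
  fixes W :: "'w set" and R E :: "'w \<Rightarrow> 'w \<Rightarrow> bool" and n :: nat
  assumes R_trans: "\<lbrakk>x \<in> W; y \<in> W; z \<in> W; R x y; R y z\<rbrakk> \<Longrightarrow> R x z"
    and depth: "x \<in> W \<Longrightarrow> \<not> deep W R n x"
    and E_refl: "x \<in> W \<Longrightarrow> E x x"
    and E_sym: "\<lbrakk>x \<in> W; y \<in> W; E x y\<rbrakk> \<Longrightarrow> E y x"
    and E_trans: "\<lbrakk>x \<in> W; y \<in> W; z \<in> W; E x y; E y z\<rbrakk> \<Longrightarrow> E x z"
    and commute: "\<lbrakk>x \<in> W; y \<in> W; z \<in> W; E x y; R y z\<rbrakk> \<Longrightarrow> \<exists>w\<in>W. R x w \<and> E w z"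
begin

abbreviation strict :: "modality \<Rightarrow> 'w \<Rightarrow> 'w \<Rightarrow> bool" where
  "strict \<equiv> case_modality R E"

abbreviation weak :: "modality \<Rightarrow> 'w \<Rightarrow> 'w \<Rightarrow> bool" where
  "weak \<equiv> case_modality R\<^sup>=\<^sup>= E"

lemma R_induct [consumes 1, case_names step]:
  assumes "x \<in> W" and "\<And>x. x \<in> W \<Longrightarrow> (\<And>y. y \<in> W \<Longrightarrow> R x y \<Longrightarrow> P y) \<Longrightarrow> P x"
  shows "P x"
  using depth assms by (rule finite_depth_induct)

text \<open>The reflexive closure adds the point itself to its successors, which is the extra
  disjunct in the clause for \<diamond>.\<close>

lemma sat_plus_translation:
  "sat W strict V w (plus_translation \<phi>) = sat W weak V w \<phi>" if "w \<in> W"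
  using that
  by (induction \<phi> arbitrary: w rule: plus_translation.induct) auto

text \<open>A refutation of \<open>bd k\<close> unrolls into a chain of k steps. \<open>S\<close> is
  \<open>strict\<close> or \<open>weak\<close>. The dummy \<open>bd 0 = Bot\<close> fails
  everywhere, so both clauses of \<open>bd\<close> yield a successor refuting the previous
  formula.\<close>

lemma deep_if_not_bd:
  assumes S: "\<And>x y. S Mod x y \<Longrightarrow> R x y \<or> x = y" and "x \<in> W" "\<not> sat W S V x (bd k)"
  shows "deep W R k x"
  using assms(2,3)
proof (induction k arbitrary: x)
  case (Suc k)
  then obtain y where y: "y \<in> W" "S Mod x y" "\<not> sat W S V y (bd k)"
      "\<And>z. z \<in> W \<Longrightarrow> S Mod y z \<Longrightarrow> V (Suc k) z" "\<not> V (Suc k) x"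
    by (cases k) auto
  \<comment> \<open>Otherwise x = y is an S-successor of itself, and the variable true at all
    S-successors of y would hold at x.\<close>
  then have "R x y"
    using S by blast
  then show ?case
    using Suc.IH y by auto
qed simp

lemma bd_strict: "bd n \<in> frame_logic W strict"
  using deep_if_not_bd[where S = strict] depth unfolding frame_logic_def by simp blast

lemma bd_weak: "bd n \<in> frame_logic W weak"
  using deep_if_not_bd[where S = weak] depth unfolding frame_logic_def by simp blast

lemma S5_le: "S5 \<subseteq> frame_logic W (\<lambda>_. E)"
  unfolding S5_def
proof (intro extension_le_frame_logic K_le_frame_logic)
  show "\<box> Var 0 \<^bold>\<rightarrow> Var 0 \<in> frame_logic W (\<lambda>_. E)"
    using E_refl by (auto simp: frame_logic_def)
  show "\<box> Var 0 \<^bold>\<rightarrow> \<box> \<box> Var 0 \<in> frame_logic W (\<lambda>_. E)"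
    by (simp add: frame_logic_def) (meson E_trans)
  show "Var 0 \<^bold>\<rightarrow> \<box> \<diamond> Var 0 \<in> frame_logic W (\<lambda>_. E)"
    by (simp add: frame_logic_def) (meson E_sym)
qed

lemma GL_le: "GL \<subseteq> frame_logic W (\<lambda>_. R)"
proof -
  \<comment> \<open>Upward induction on y: points above y are above x by transitivity, so V holds
    there by induction and the premise gives V at y.\<close>
  have *: "R x y \<longrightarrow> V y"
    if "x \<in> W" "y \<in> W" and *: "\<And>y. y \<in> W \<Longrightarrow> R x y \<Longrightarrow> (\<forall>z\<in>W. R y z \<longrightarrow> V z) \<Longrightarrow> V y" for x y V
    using \<open>y \<in> W\<close>
  proof (induction rule: R_induct)
    case (step y)
    then show ?case
      using * R_trans \<open>x \<in> W\<close> by blast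
  qed
  have "sat W (\<lambda>_. R) V x (\<box> (\<box> Var 0 \<^bold>\<rightarrow> Var 0) \<^bold>\<rightarrow> \<box> Var 0)" if "x \<in> W" for V x
    using *[OF that, of _ "V 0"] unfolding sat_Box sat.simps by blast
  then show ?thesis
    unfolding GL_def
    by (intro extension_le_frame_logic K_le_frame_logic)
      (simp only: frame_logic_def mem_Collect_eq, blast)
qed

lemma Grz_le: "Grz \<subseteq> frame_logic W (\<lambda>_. R\<^sup>=\<^sup>=)"
proof -
  have "V x"
    if "x \<in> W" and *: "\<And>y. y \<in> W \<Longrightarrow> R\<^sup>=\<^sup>= x y \<Longrightarrow>
        (\<forall>z\<in>W. R\<^sup>=\<^sup>= y z \<longrightarrow> V z \<longrightarrow> (\<forall>u\<in>W. R\<^sup>=\<^sup>= z u \<longrightarrow> V u)) \<Longrightarrow> V y" for x V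
  proof -
    have "R\<^sup>=\<^sup>= x y \<longrightarrow> V y" if "y \<in> W" for y
      using that
    proof (induction rule: R_induct)
      case (step y)
      show ?case
      proof
        assume "R\<^sup>=\<^sup>= x y"
        \<comment> \<open>Once V holds strictly above y, it persists from every point weakly above
          y, so the premise applies to y.\<close>
        then have above: "V u" if "u \<in> W" "R y u" for u
          using step.IH[OF that] R_trans[of x y u] step.hyps that \<open>x \<in> W\<close> by auto
        have "V u" if "z \<in> W" "R\<^sup>=\<^sup>= y z" "V z" "u \<in> W" "R\<^sup>=\<^sup>= z u" for z u
          using above R_trans[of y z u] step.hyps that by auto
        then show "V y"
          using * \<open>R\<^sup>=\<^sup>= x y\<close> step.hyps by blast
      qed
    qed
    then show ?thesis
      using \<open>x \<in> W\<close> by simp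
  qed
  note * = this
  have "sat W (\<lambda>_. R\<^sup>=\<^sup>=) V x (\<box> (\<box> (Var 0 \<^bold>\<rightarrow> \<box> Var 0) \<^bold>\<rightarrow> Var 0) \<^bold>\<rightarrow> Var 0)" if "x \<in> W" for V x
    using *[OF that, of "V 0"] unfolding sat_Box sat.simps by blast
  then show ?thesis
    unfolding Grz_def
    by (intro extension_le_frame_logic K_le_frame_logic)
      (simp only: frame_logic_def mem_Collect_eq, blast)
qed

lemma monadic_strict: "monadic GL \<subseteq> frame_logic W strict"
  unfolding monadic_def
proof (intro extension_le_frame_logic fusion_le_frame_logic)
  show "\<^bold>\<exists> \<^bold>\<diamond> Var 0 \<^bold>\<rightarrow> \<^bold>\<diamond> \<^bold>\<exists> Var 0 \<in> frame_logic W strict"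
    by (simp add: frame_logic_def) (meson commute)
qed (simp_all add: GL_le S5_le)

lemma commute_weak:
  "\<lbrakk>x \<in> W; y \<in> W; z \<in> W; E x y; R\<^sup>=\<^sup>= y z\<rbrakk> \<Longrightarrow> \<exists>w\<in>W. R\<^sup>=\<^sup>= x w \<and> E w z"
  using commute by blast

lemma monadic_weak: "monadic Grz \<subseteq> frame_logic W weak"
  unfolding monadic_def
proof (intro extension_le_frame_logic fusion_le_frame_logic)
  show "\<^bold>\<exists> \<^bold>\<diamond> Var 0 \<^bold>\<rightarrow> \<^bold>\<diamond> \<^bold>\<exists> Var 0 \<in> frame_logic W weak"
    by (simp add: frame_logic_def del: sup_apply) (meson commute_weak)
qed (simp_all add: Grz_le S5_le del: sup_apply)

text \<open>The accessibility relation of the compound modality \<box>\<forall> in the weak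
  frame.\<close>

definition Q :: "'w \<Rightarrow> 'w \<Rightarrow> bool" where
  "Q x z \<longleftrightarrow> (\<exists>y\<in>W. R\<^sup>=\<^sup>= x y \<and> E y z)"

text \<open>\<open>commute\<close> exchanges the inner E-step with the R-step after it, which makes
  the two R-steps and the two E-steps adjacent.\<close>

lemma Q_trans: "\<lbrakk>x \<in> W; y \<in> W; z \<in> W; Q x y; Q y z\<rbrakk> \<Longrightarrow> Q x z"
  for x y z
proof -
  assume W: "x \<in> W" "y \<in> W" "z \<in> W" and "Q x y" "Q y z"
  then obtain a b where ab: "a \<in> W" "b \<in> W" "R\<^sup>=\<^sup>= x a" "E a y" "R\<^sup>=\<^sup>= y b" "E b z"
    by (auto simp: Q_def)
  then obtain w where w: "w \<in> W" "R\<^sup>=\<^sup>= a w" "E w b"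
    using commute_weak W by blast
  have "R\<^sup>=\<^sup>= x w"
    using ab w W R_trans[of x a w] by auto
  moreover have "E w z"
    using E_trans ab w W by blast
  ultimately show ?thesis
    using w by (auto simp: Q_def)
qed

text \<open>Otherwise let \<open>v\<close> be an \<open>R\<close>-last point above \<open>x\<close> refuting \<open>\<box>\<forall>p\<close>. Then \<open>p\<close> fails at some \<open>t\<close> with
  \<open>E v t\<close>, the premise at \<open>t\<close> gives a point strictly above \<open>t\<close> refuting \<open>\<box>\<forall>p\<close>, and \<open>commute\<close> one
  strictly above \<open>v\<close>.\<close>

lemma Cas_semantic:
  assumes "x \<in> W"
    and prem: "\<And>v. v \<in> W \<Longrightarrow> Q x v \<Longrightarrow>
      (\<forall>u\<in>W. R\<^sup>=\<^sup>= v u \<longrightarrow> (\<forall>s\<in>W. R\<^sup>=\<^sup>= u s \<longrightarrow> p s) \<longrightarrow> (\<forall>t\<in>W. Q u t \<longrightarrow> p t)) \<Longrightarrow>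
      (\<forall>t\<in>W. Q v t \<longrightarrow> p t)"
    and "t \<in> W" "Q x t"
  shows "p t"
proof -
  have *: "v \<in> W \<Longrightarrow> Q x v \<longrightarrow> (\<forall>t\<in>W. Q v t \<longrightarrow> p t)" for v
  proof (induction v rule: R_induct)
    case (step v)
    show ?case
    proof (rule ccontr)
      assume "\<not> ?thesis"
      then have v: "Q x v" "\<exists>t\<in>W. Q v t \<and> \<not> p t"
        by auto
      have later: "\<not> (\<exists>t\<in>W. Q u t \<and> \<not> p t)" if "u \<in> W" "R v u" for u
        using step that v(1) \<open>x \<in> W\<close> E_refl Q_trans[of x v u] by (auto simp: Q_def)
      obtain s t where st: "s \<in> W" "t \<in> W" "R\<^sup>=\<^sup>= v s" "E s t" "\<not> p t"
        using v(2) by (auto simp: Q_def)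
      have "s = v"
        using later[of s] st by (auto simp: Q_def)
      then have "E v t"
        using st by simp
      have "Q v t" "Q t t"
        using \<open>E v t\<close> step.hyps st E_refl by (auto simp: Q_def)
      then have "Q x t"
        using Q_trans[of x v t] v step.hyps st \<open>x \<in> W\<close> by simp
      have "\<not> (\<forall>t'\<in>W. Q t t' \<longrightarrow> p t')"
        using \<open>Q t t\<close> st by blast
      then obtain u where u: "u \<in> W" "R\<^sup>=\<^sup>= t u" "\<forall>s\<in>W. R\<^sup>=\<^sup>= u s \<longrightarrow> p s" "\<exists>t\<in>W. Q u t \<and> \<not> p t"
        using prem[OF \<open>t \<in> W\<close> \<open>Q x t\<close>] by blast
      then have "R t u"
        using st by fastforce
      then obtain w where w: "w \<in> W" "R v w" "E w u"
        using commute[of v t u] step.hyps st u \<open>E v t\<close> by blast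
      then have "Q w u"
        by (auto simp: Q_def)
      then show False
        using later[OF w(1,2)] Q_trans[OF w(1) u(1)] u by blast
    qed
  qed
  have "Q x x"
    using \<open>x \<in> W\<close> E_refl by (auto simp: Q_def)
  then show ?thesis
    using *[OF \<open>x \<in> W\<close>] assms(3,4) by simp
qed

lemma sat_box_all:
  "sat W weak V u (\<^bold>\<box> \<^bold>\<forall> \<phi>) \<longleftrightarrow> (\<forall>t\<in>W. Q u t \<longrightarrow> sat W weak V t \<phi>)"
  unfolding sat_Box Q_def modality.case by blast

lemma Cas_weak: "Cas \<in> frame_logic W weak"
proof -
  have "sat W weak V x Cas" if "x \<in> W" for x V
  proof -
    let ?C = "\<^bold>\<box> \<^bold>\<forall> Var 0" and ?D = "\<^bold>\<box> (\<^bold>\<box> Var 0 \<^bold>\<rightarrow> \<^bold>\<box> \<^bold>\<forall> Var 0)"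
    have "sat W weak V x ?C" if prem: "sat W weak V x (\<^bold>\<box> \<^bold>\<forall> (?D \<^bold>\<rightarrow> ?C))"
      unfolding sat_box_all sat.simps(1)
    proof (intro ballI impI)
      fix t assume t: "t \<in> W" "Q x t"
      have prem': "sat W weak V v ?D \<Longrightarrow> sat W weak V v ?C" if "v \<in> W" "Q x v" for v
        using prem that unfolding sat_box_all sat.simps(3)[of _ _ _ _ ?D ?C] by blast
      have D: "sat W weak V v ?D \<longleftrightarrow> (\<forall>u\<in>W. R\<^sup>=\<^sup>= v u \<longrightarrow> (\<forall>s\<in>W. R\<^sup>=\<^sup>= u s \<longrightarrow> V 0 s) \<longrightarrow>
          (\<forall>t\<in>W. Q u t \<longrightarrow> V 0 t))" for v
        unfolding sat_Box[of _ _ _ _ _ "_ \<^bold>\<rightarrow> ?C"] sat.simps(3)[of _ _ _ _ _ ?C] sat_box_all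
        unfolding sat_Box sat.simps(1) modality.case ..
      show "V 0 t"
        by (rule Cas_semantic[OF \<open>x \<in> W\<close> _ t, of "V 0"])
          (rule prem'[unfolded D sat_box_all sat.simps(1)])
    qed
    then show ?thesis
      unfolding Cas_def sat.simps(3)[of _ _ _ _ _ ?C] by blast
  qed
  then show ?thesis
    by (simp add: frame_logic_def)
qed

lemma MGL_le: "MGL\<^bold>[n\<^bold>] \<subseteq> frame_logic W strict"
  unfolding finite_depth_def MGL_def
  by (intro extension_le_frame_logic monadic_strict bd_strict)

lemma MplusGrz_le: "MplusGrz\<^bold>[n\<^bold>] \<subseteq> frame_logic W weak"
  unfolding finite_depth_def MplusGrz_def MGrz_def
  by (intro extension_le_frame_logic monadic_weak Cas_weak bd_weak)

end

locale monadic_barcan_frame = monadic_frame +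
  assumes barcan: "\<lbrakk>x \<in> W; y \<in> W; z \<in> W; R x y; E y z\<rbrakk> \<Longrightarrow> \<exists>w\<in>W. E x w \<and> R w z"
begin

lemma MGLB_le: "MGLB\<^bold>[n\<^bold>] \<subseteq> frame_logic W strict"
  unfolding finite_depth_def MGLB_def monadicB_def
proof (intro extension_le_frame_logic monadic_strict bd_strict)
  show "\<^bold>\<diamond> \<^bold>\<exists> Var 0 \<^bold>\<rightarrow> \<^bold>\<exists> \<^bold>\<diamond> Var 0 \<in> frame_logic W strict"
    by (simp add: frame_logic_def) (meson barcan)
qed

lemma barcan_weak:
  "\<lbrakk>x \<in> W; y \<in> W; z \<in> W; R\<^sup>=\<^sup>= x y; E y z\<rbrakk> \<Longrightarrow> \<exists>w\<in>W. E x w \<and> R\<^sup>=\<^sup>= w z"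
  using barcan by blast

lemma MplusGrzB_le: "MplusGrzB\<^bold>[n\<^bold>] \<subseteq> frame_logic W weak"
  unfolding finite_depth_def MplusGrzB_def MGrzB_def monadicB_def
proof (intro extension_le_frame_logic monadic_weak Cas_weak bd_weak)
  show "\<^bold>\<diamond> \<^bold>\<exists> Var 0 \<^bold>\<rightarrow> \<^bold>\<exists> \<^bold>\<diamond> Var 0 \<in> frame_logic W weak"
    by (simp add: frame_logic_def del: sup_apply) (meson barcan_weak)
qed

end

section \<open>Canonical models\<close>

instance form :: (countable) countable
  by countable_datatype

text \<open>A fusion receives its tautologies from the unimodal languages. Coding atoms and modal
  subformulas by variables exhibits every tautology of the larger language as a substitution
  instance of a unimodal one.\<close>

primrec abstract_atoms :: "'m::countable form \<Rightarrow> unit form" where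
  "abstract_atoms (Var i) = Var (to_nat (Var i :: 'm form))"
| "abstract_atoms Bot = Bot"
| "abstract_atoms (\<phi> \<^bold>\<rightarrow> \<psi>) = abstract_atoms \<phi> \<^bold>\<rightarrow> abstract_atoms \<psi>"
| "abstract_atoms (Dia m \<phi>) = Var (to_nat (Dia m \<phi>))"

lemma subst_abstract_atoms: "subst from_nat (map_form f (abstract_atoms \<phi>)) = \<phi>"
  by (induction \<phi>) simp_all

lemma ptrue_abstract_atoms:
  "ptrue v (abstract_atoms \<phi>) = ptrue (\<lambda>\<psi>. v (Var (to_nat \<psi>))) \<phi>"
  by (induction \<phi>) simp_all

section \<open>Maximal consistent theories of a normal logic\<close>

locale normal_logic =
  fixes L :: "'m form set"
  assumes tautologies_le: "tautologies \<subseteq> L"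
    and mp: "\<phi> \<^bold>\<rightarrow> \<psi> \<in> L \<Longrightarrow> \<phi> \<in> L \<Longrightarrow> \<psi> \<in> L"
    and subst_closed: "\<phi> \<in> L \<Longrightarrow> subst \<sigma> \<phi> \<in> L"
    and nec: "\<phi> \<in> L \<Longrightarrow> Box m \<phi> \<in> L"
    and K_axiom: "Box m (Var 0 \<^bold>\<rightarrow> Var 1) \<^bold>\<rightarrow> Box m (Var 0) \<^bold>\<rightarrow> Box m (Var 1) \<in> L"
    and dual_axiom: "(Dia m (Var 0) \<^bold>\<leftrightarrow> \<^bold>\<not> Box m (\<^bold>\<not> Var 0)) \<in> L"
begin

lemma tautology: "(\<And>v. ptrue v \<phi>) \<Longrightarrow> \<phi> \<in> L"
  using tautologies_le by (auto simp: tautologies_def)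

text \<open>Modus ponens is the sole closure rule: substitution and necessitation preserve validity
  but not truth at a point.\<close>

definition closed_theory :: "'m form set \<Rightarrow> bool" where
  "closed_theory T \<longleftrightarrow> L \<subseteq> T \<and> (\<forall>\<phi> \<psi>. \<phi> \<^bold>\<rightarrow> \<psi> \<in> T \<longrightarrow> \<phi> \<in> T \<longrightarrow> \<psi> \<in> T)"

lemma closed_theory_L: "closed_theory L"
  using mp by (auto simp: closed_theory_def)

lemma closed_theory_mp: "closed_theory T \<Longrightarrow> \<phi> \<^bold>\<rightarrow> \<psi> \<in> T \<Longrightarrow> \<phi> \<in> T \<Longrightarrow> \<psi> \<in> T"
  by (auto simp: closed_theory_def)

lemma closed_theory_tautology: "closed_theory T \<Longrightarrow> (\<And>v. ptrue v \<phi>) \<Longrightarrow> \<phi> \<in> T"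
  using tautology by (auto simp: closed_theory_def)

lemma closed_theory_mp_tautology:
  assumes "closed_theory T" "\<phi> \<in> T" "\<And>v. ptrue v \<phi> \<Longrightarrow> ptrue v \<psi>"
  shows "\<psi> \<in> T"
proof -
  have "\<phi> \<^bold>\<rightarrow> \<psi> \<in> T"
    using assms by (intro closed_theory_tautology) auto
  then show ?thesis
    using assms closed_theory_mp by blast
qed

lemma closed_theory_mp_tautology2:
  assumes "closed_theory T" "\<phi> \<in> T" "\<psi> \<in> T" "\<And>v. ptrue v \<phi> \<Longrightarrow> ptrue v \<psi> \<Longrightarrow> ptrue v \<chi>"
  shows "\<chi> \<in> T"
proof -
  have "\<psi> \<^bold>\<rightarrow> \<chi> \<in> T"
    by (rule closed_theory_mp_tautology[OF assms(1,2)]) (simp add: assms(4))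
  then show ?thesis
    using assms closed_theory_mp by blast
qed

text \<open>The theory generated by T and \<psi>, in the form given by the deduction
  theorem.\<close>

definition adjoin :: "'m form set \<Rightarrow> 'm form \<Rightarrow> 'm form set" where
  "adjoin T \<psi> = {\<chi>. \<psi> \<^bold>\<rightarrow> \<chi> \<in> T}"

lemma closed_theory_adjoin:
  assumes "closed_theory T"
  shows "closed_theory (adjoin T \<psi>)" and "T \<subseteq> adjoin T \<psi>" and "\<psi> \<in> adjoin T \<psi>"
proof -
  show le: "T \<subseteq> adjoin T \<psi>"
  proof
    fix \<chi> assume "\<chi> \<in> T"
    then show "\<chi> \<in> adjoin T \<psi>"
      unfolding adjoin_def mem_Collect_eq
      by (rule closed_theory_mp_tautology[OF assms]) simp
  qed
  show "\<psi> \<in> adjoin T \<psi>"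
    using assms by (auto simp: adjoin_def intro: closed_theory_tautology)
  have "\<psi> \<^bold>\<rightarrow> \<chi> \<in> T" if "\<psi> \<^bold>\<rightarrow> \<alpha> \<^bold>\<rightarrow> \<chi> \<in> T" "\<psi> \<^bold>\<rightarrow> \<alpha> \<in> T" for \<alpha> \<chi>
    using that by (rule closed_theory_mp_tautology2[OF assms]) simp
  then show "closed_theory (adjoin T \<psi>)"
    using le assms by (auto simp: closed_theory_def adjoin_def)
qed

definition worlds :: "'m form set set" where
  "worlds = {x. closed_theory x \<and> Bot \<notin> x \<and> (\<forall>\<phi>. \<phi> \<in> x \<or> \<^bold>\<not> \<phi> \<in> x)}"

text \<open>Zorn's lemma for theories omitting \<phi>. A maximal one decides every \<psi>: otherwise
  both \<psi> and its negation would imply \<phi> there, and \<phi> would be a member.\<close>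

lemma lindenbaum:
  assumes "closed_theory T" and "\<phi> \<notin> T"
  obtains x where "x \<in> worlds" "T \<subseteq> x" "\<phi> \<notin> x"
proof -
  let ?A = "{M. closed_theory M \<and> T \<subseteq> M \<and> \<phi> \<notin> M}"
  have "\<exists>M\<in>?A. \<forall>X\<in>?A. M \<subseteq> X \<longrightarrow> X = M"
  proof (rule subset_Zorn_nonempty)
    show "?A \<noteq> {}"
      using assms by auto
    fix C assume C: "C \<noteq> {}" "subset.chain ?A C"
    have "\<psi> \<in> \<Union>C" if imp: "\<chi> \<^bold>\<rightarrow> \<psi> \<in> \<Union>C" "\<chi> \<in> \<Union>C" for \<chi> \<psi>
    proof -
      obtain M N where MN: "M \<in> C" "N \<in> C" "\<chi> \<^bold>\<rightarrow> \<psi> \<in> M" "\<chi> \<in> N"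
        using imp by blast
      then have "M \<subseteq> N \<or> N \<subseteq> M"
        using C by (auto simp: subset.chain_def)
      moreover have "closed_theory M" "closed_theory N"
        using MN C by (auto simp: subset.chain_def)
      ultimately show ?thesis
        using MN closed_theory_mp by blast
    qed
    moreover have "L \<subseteq> \<Union>C" "T \<subseteq> \<Union>C" "\<phi> \<notin> \<Union>C"
      using C by (fastforce simp: subset.chain_def closed_theory_def)+
    ultimately show "\<Union>C \<in> ?A"
      unfolding closed_theory_def by blast
  qed
  then obtain M where M: "closed_theory M" "T \<subseteq> M" "\<phi> \<notin> M"
    and max: "\<And>X. closed_theory X \<Longrightarrow> T \<subseteq> X \<Longrightarrow> \<phi> \<notin> X \<Longrightarrow> M \<subseteq> X \<Longrightarrow> X = M"
    by auto
  \<comment> \<open>By maximality, adjoining a missing \<psi> must bring \<phi> in.\<close>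
  have imp: "\<psi> \<^bold>\<rightarrow> \<phi> \<in> M" if "\<psi> \<notin> M" for \<psi>
    using max[of "adjoin M \<psi>"] closed_theory_adjoin[OF M(1), of \<psi>] M(2) that
    by (auto simp: adjoin_def)
  have "\<psi> \<in> M \<or> \<^bold>\<not> \<psi> \<in> M" for \<psi>
  proof (rule ccontr)
    assume "\<not> ?thesis"
    then have "\<psi> \<^bold>\<rightarrow> \<phi> \<in> M" "\<^bold>\<not> \<psi> \<^bold>\<rightarrow> \<phi> \<in> M"
      using imp by auto
    then have "\<phi> \<in> M"
      by (rule closed_theory_mp_tautology2[OF M(1)]) auto
    then show False
      using M by simp
  qed
  moreover have "Bot \<notin> M"
    using closed_theory_mp_tautology[OF M(1), of Bot \<phi>] M(3) by auto
  ultimately have "M \<in> worlds"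
    using M by (simp add: worlds_def)
  then show thesis
    using M that by blast
qed

lemma world_closed: "x \<in> worlds \<Longrightarrow> closed_theory x"
  by (simp add: worlds_def)

lemma mem_L_iff: "\<phi> \<in> L \<longleftrightarrow> (\<forall>x\<in>worlds. \<phi> \<in> x)"
  using lindenbaum[OF closed_theory_L] world_closed by (metis closed_theory_def subsetD)

lemma Bot_notin_world [simp]: "x \<in> worlds \<Longrightarrow> Bot \<notin> x"
  by (simp add: worlds_def)

lemma Imp_mem_world [simp]: "\<phi> \<^bold>\<rightarrow> \<psi> \<in> x \<longleftrightarrow> (\<phi> \<in> x \<longrightarrow> \<psi> \<in> x)" if x: "x \<in> worlds"
proof -
  have "\<phi> \<^bold>\<rightarrow> \<psi> \<in> x" if "\<phi> \<notin> x"
  proof -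
    have "\<^bold>\<not> \<phi> \<in> x"
      using that x unfolding worlds_def by blast
    then show ?thesis
      by (rule closed_theory_mp_tautology[OF world_closed[OF x]]) simp
  qed
  moreover have "\<phi> \<^bold>\<rightarrow> \<psi> \<in> x" if "\<psi> \<in> x"
    using that by (rule closed_theory_mp_tautology[OF world_closed[OF x]]) simp
  moreover have "\<psi> \<in> x" if "\<phi> \<^bold>\<rightarrow> \<psi> \<in> x" "\<phi> \<in> x"
    using that closed_theory_mp[OF world_closed[OF x]] by blast
  ultimately show ?thesis
    by blast
qed

lemma worlds_eqI: "\<lbrakk>x \<in> worlds; y \<in> worlds; x \<subseteq> y\<rbrakk> \<Longrightarrow> x = y"
proof -
  assume xy: "x \<in> worlds" "y \<in> worlds" "x \<subseteq> y"
  have "\<phi> \<in> x" if "\<phi> \<in> y" for \<phi>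
  proof (rule ccontr)
    assume "\<phi> \<notin> x"
    then have "\<^bold>\<not> \<phi> \<in> y"
      using xy(3) Imp_mem_world[OF xy(1), of \<phi> Bot] by blast
    then show False
      using that xy by simp
  qed
  then show "x = y"
    using xy by blast
qed

section \<open>Canonical accessibility and the truth lemma\<close>

definition access :: "'m \<Rightarrow> 'm form set \<Rightarrow> 'm form set \<Rightarrow> bool" where
  "access m x y \<longleftrightarrow> (\<forall>\<phi>. Box m \<phi> \<in> x \<longrightarrow> \<phi> \<in> y)"

lemma instance_mem: "\<lbrakk>\<phi> \<in> L; x \<in> worlds\<rbrakk> \<Longrightarrow> subst \<sigma> \<phi> \<in> x"
  using subst_closed world_closed by (auto simp: closed_theory_def)

lemma K_mem: "\<lbrakk>x \<in> worlds; Box m (\<phi> \<^bold>\<rightarrow> \<psi>) \<in> x; Box m \<phi> \<in> x\<rbrakk> \<Longrightarrow> Box m \<psi> \<in> x"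
  using instance_mem[OF K_axiom, of x "\<lambda>i. if i = 0 then \<phi> else \<psi>" m]
  by (simp del: Imp_mem_world) (meson closed_theory_mp world_closed)

lemma dual_mem: "x \<in> worlds \<Longrightarrow> Dia m \<phi> \<in> x \<longleftrightarrow> Box m (\<^bold>\<not> \<phi>) \<notin> x"
  using instance_mem[OF dual_axiom, of x "\<lambda>_. \<phi>" m] by auto

lemma closed_theory_boxed: "x \<in> worlds \<Longrightarrow> closed_theory {\<phi>. Box m \<phi> \<in> x}"
  using nec mem_L_iff K_mem unfolding closed_theory_def by blast

lemma access_witness:
  assumes x: "x \<in> worlds" and "Dia m \<phi> \<in> x"
  obtains y where "y \<in> worlds" "access m x y" "\<phi> \<in> y"
proof -
  let ?T = "{\<phi>. Box m \<phi> \<in> x}"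
  have "Bot \<notin> adjoin ?T \<phi>"
    using assms dual_mem by (simp add: adjoin_def del: Imp_mem_world)
  then obtain y where y: "y \<in> worlds" "adjoin ?T \<phi> \<subseteq> y"
    by (rule lindenbaum[OF closed_theory_adjoin(1)[OF closed_theory_boxed[OF x]]])
  have "?T \<subseteq> y" "\<phi> \<in> y"
    using y closed_theory_adjoin(2,3)[OF closed_theory_boxed[OF x, of m], where ?\<psi> = \<phi>] by blast+
  then show thesis
    using that[OF y(1)] by (auto simp: access_def)
qed

lemma Dia_mem_world [simp]:
  "x \<in> worlds \<Longrightarrow> Dia m \<phi> \<in> x \<longleftrightarrow> (\<exists>y\<in>worlds. access m x y \<and> \<phi> \<in> y)"
proof
  assume x: "x \<in> worlds" and "\<exists>y\<in>worlds. access m x y \<and> \<phi> \<in> y"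
  then obtain y where y: "y \<in> worlds" "access m x y" "\<phi> \<in> y"
    by blast
  then have "\<^bold>\<not> \<phi> \<notin> y"
    by simp
  then show "Dia m \<phi> \<in> x"
    using y dual_mem[OF x] unfolding access_def by blast
qed (meson access_witness)

lemma Box_mem_world:
  "x \<in> worlds \<Longrightarrow> Box m \<phi> \<in> x \<longleftrightarrow> (\<forall>y\<in>worlds. access m x y \<longrightarrow> \<phi> \<in> y)"
  by auto

lemma accessI:
  assumes "x \<in> worlds" "y \<in> worlds" "\<And>\<phi>. \<phi> \<in> y \<Longrightarrow> Dia m \<phi> \<in> x"
  shows "access m x y"
  unfolding access_def
proof (intro allI impI, rule ccontr)
  fix \<phi> assume "Box m \<phi> \<in> x" "\<phi> \<notin> y"
  then have "\<^bold>\<not> \<phi> \<in> y"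
    using assms(2) by simp
  then have "Dia m (\<^bold>\<not> \<phi>) \<in> x"
    by (rule assms(3))
  then show False
    using \<open>Box m \<phi> \<in> x\<close> assms(1) by (simp del: Dia_mem_world)
qed

lemma sat_canonical: "x \<in> worlds \<Longrightarrow> sat worlds access (\<lambda>i x. Var i \<in> x) x \<phi> \<longleftrightarrow> \<phi> \<in> x"
  by (induction \<phi> arbitrary: x) auto

text \<open>An existence lemma for two-step paths with both ends prescribed. It makes the two
  interaction axioms canonical: a, b are \<diamond>, \<exists> for the commutation axiom and
  \<exists>, \<diamond> for Barcan.\<close>

lemma access_composition:
  assumes x: "x \<in> worlds" and z: "z \<in> worlds"
    and dia: "\<And>\<psi>. \<psi> \<in> z \<Longrightarrow> Dia a (Dia b \<psi>) \<in> x"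
  shows "\<exists>w\<in>worlds. access a x w \<and> access b w z"
proof -
  \<comment> \<open>The theory that the middle point w must contain: everything boxed at x, and
    \<open>Dia b \<psi>\<close> for each \<psi> in z. A single \<psi> suffices since z is closed
    under conjunction.\<close>
  let ?T = "{\<chi>. \<exists>\<psi>\<in>z. Box a (Dia b \<psi> \<^bold>\<rightarrow> \<chi>) \<in> x}"
  have "\<chi> \<in> ?T" if imp: "\<alpha> \<^bold>\<rightarrow> \<chi> \<in> ?T" "\<alpha> \<in> ?T" for \<alpha> \<chi>
  proof -
    obtain \<beta> \<gamma> where \<psi>: "\<beta> \<in> z" "Box a (Dia b \<beta> \<^bold>\<rightarrow> \<alpha> \<^bold>\<rightarrow> \<chi>) \<in> x"
        "\<gamma> \<in> z" "Box a (Dia b \<gamma> \<^bold>\<rightarrow> \<alpha>) \<in> x"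
      using imp by blast
    have "Box a (Dia b (\<beta> \<^bold>\<and> \<gamma>) \<^bold>\<rightarrow> \<chi>) \<in> x"
      unfolding Box_mem_world[OF x]
    proof (intro ballI impI)
      fix y assume y: "y \<in> worlds" "access a x y"
      then have "Dia b \<beta> \<^bold>\<rightarrow> \<alpha> \<^bold>\<rightarrow> \<chi> \<in> y" "Dia b \<gamma> \<^bold>\<rightarrow> \<alpha> \<in> y"
        using \<psi> unfolding access_def by blast+
      then show "Dia b (\<beta> \<^bold>\<and> \<gamma>) \<^bold>\<rightarrow> \<chi> \<in> y"
        using y by auto
    qed
    moreover have "\<beta> \<^bold>\<and> \<gamma> \<in> z"
      using \<psi> z by simp
    ultimately show ?thesis
      by blast
  qed
  moreover have "L \<subseteq> ?T"
  proof
    fix \<phi> assume "\<phi> \<in> L"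
    then have "Box a (Dia b (Bot \<^bold>\<rightarrow> Bot) \<^bold>\<rightarrow> \<phi>) \<in> x"
      using mem_L_iff x by (simp add: Box_mem_world)
    moreover have "Bot \<^bold>\<rightarrow> Bot \<in> z"
      using z by simp
    ultimately show "\<phi> \<in> ?T"
      by blast
  qed
  ultimately have "closed_theory ?T"
    unfolding closed_theory_def by blast
  moreover have "Bot \<notin> ?T"
  proof
    assume "Bot \<in> ?T"
    then obtain \<psi> where "\<psi> \<in> z" "Box a (\<^bold>\<not> Dia b \<psi>) \<in> x"
      by blast
    then show False
      using dia dual_mem[OF x] by blast
  qed
  ultimately obtain w where w: "w \<in> worlds" "?T \<subseteq> w"
    by (rule lindenbaum)
  have "access a x w"
    unfolding access_def
  proof (intro allI impI)
    fix \<phi> assume "Box a \<phi> \<in> x"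
    then have "Box a (Dia b (Bot \<^bold>\<rightarrow> Bot) \<^bold>\<rightarrow> \<phi>) \<in> x"
      using x by (simp add: Box_mem_world)
    moreover have "Bot \<^bold>\<rightarrow> Bot \<in> z"
      using z by simp
    ultimately show "\<phi> \<in> w"
      using w by blast
  qed
  moreover have "access b w z"
  proof (rule accessI[OF w(1) z])
    fix \<psi> assume "\<psi> \<in> z"
    moreover have "Box a (Dia b \<psi> \<^bold>\<rightarrow> Dia b \<psi>) \<in> x"
      using x by simp
    ultimately show "Dia b \<psi> \<in> w"
      using w by blast
  qed
  ultimately show ?thesis
    using w by blast
qed

end

locale monadic_logic = normal_logic L for L :: "mform set" +
  assumes T_axiom: "\<^bold>\<forall> Var 0 \<^bold>\<rightarrow> Var 0 \<in> L"
    and Four_axiom: "\<^bold>\<forall> Var 0 \<^bold>\<rightarrow> \<^bold>\<forall> \<^bold>\<forall> Var 0 \<in> L"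
    and B_axiom: "Var 0 \<^bold>\<rightarrow> \<^bold>\<forall> \<^bold>\<exists> Var 0 \<in> L"
    and commute_axiom: "\<^bold>\<exists> \<^bold>\<diamond> Var 0 \<^bold>\<rightarrow> \<^bold>\<diamond> \<^bold>\<exists> Var 0 \<in> L"
begin

abbreviation E where "E \<equiv> access Qua"

lemma E_refl: "x \<in> worlds \<Longrightarrow> E x x"
  unfolding access_def
proof (intro allI impI)
  fix \<phi> assume "x \<in> worlds" "\<^bold>\<forall> \<phi> \<in> x"
  moreover have "\<^bold>\<forall> \<phi> \<^bold>\<rightarrow> \<phi> \<in> x"
    using instance_mem[OF T_axiom \<open>x \<in> worlds\<close>, of "\<lambda>_. \<phi>"] by simp
  ultimately show "\<phi> \<in> x"
    using closed_theory_mp world_closed by blast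
qed

lemma E_trans: "\<lbrakk>x \<in> worlds; y \<in> worlds; z \<in> worlds; E x y; E y z\<rbrakk> \<Longrightarrow> E x z"
  unfolding access_def[of _ x z]
proof (intro allI impI)
  fix \<phi> assume *: "x \<in> worlds" "E x y" "E y z" "\<^bold>\<forall> \<phi> \<in> x"
  have "\<^bold>\<forall> \<phi> \<^bold>\<rightarrow> \<^bold>\<forall> \<^bold>\<forall> \<phi> \<in> x"
    using instance_mem[OF Four_axiom \<open>x \<in> worlds\<close>, of "\<lambda>_. \<phi>"] by simp
  then have "\<^bold>\<forall> \<^bold>\<forall> \<phi> \<in> x"
    using * closed_theory_mp world_closed by blast
  then show "\<phi> \<in> z"
    using * unfolding access_def by blast
qed

lemma E_sym: "\<lbrakk>x \<in> worlds; y \<in> worlds; E x y\<rbrakk> \<Longrightarrow> E y x"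
proof (rule accessI)
  fix \<phi> assume *: "x \<in> worlds" "E x y" "\<phi> \<in> x"
  have "\<phi> \<^bold>\<rightarrow> \<^bold>\<forall> \<^bold>\<exists> \<phi> \<in> x"
    using instance_mem[OF B_axiom \<open>x \<in> worlds\<close>, of "\<lambda>_. \<phi>"] by simp
  then have "\<^bold>\<forall> \<^bold>\<exists> \<phi> \<in> x"
    using * closed_theory_mp world_closed by blast
  then show "\<^bold>\<exists> \<phi> \<in> y"
    using * unfolding access_def by blast
qed

lemma E_commute:
  assumes "x \<in> worlds" "y \<in> worlds" "z \<in> worlds" "E x y" "access Mod y z"
  shows "\<exists>w\<in>worlds. access Mod x w \<and> E w z"
proof (rule access_composition)
  fix \<psi> assume "\<psi> \<in> z"
  have "\<^bold>\<exists> \<^bold>\<diamond> \<psi> \<^bold>\<rightarrow> \<^bold>\<diamond> \<^bold>\<exists> \<psi> \<in> x"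
    using instance_mem[OF commute_axiom \<open>x \<in> worlds\<close>, of "\<lambda>_. \<psi>"] by simp
  moreover have "\<^bold>\<exists> \<^bold>\<diamond> \<psi> \<in> x"
    using assms \<open>\<psi> \<in> z\<close> by auto
  ultimately show "\<^bold>\<diamond> \<^bold>\<exists> \<psi> \<in> x"
    using assms closed_theory_mp world_closed by blast
qed (use assms in auto)

lemma E_barcan:
  assumes "\<^bold>\<diamond> \<^bold>\<exists> Var 0 \<^bold>\<rightarrow> \<^bold>\<exists> \<^bold>\<diamond> Var 0 \<in> L"
    and "x \<in> worlds" "y \<in> worlds" "z \<in> worlds" "access Mod x y" "E y z"
  shows "\<exists>w\<in>worlds. E x w \<and> access Mod w z"
proof (rule access_composition)
  fix \<psi> assume "\<psi> \<in> z"
  have "\<^bold>\<diamond> \<^bold>\<exists> \<psi> \<^bold>\<rightarrow> \<^bold>\<exists> \<^bold>\<diamond> \<psi> \<in> x"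
    using instance_mem[OF assms(1,2), of "\<lambda>_. \<psi>"] by simp
  moreover have "\<^bold>\<diamond> \<^bold>\<exists> \<psi> \<in> x"
    using assms \<open>\<psi> \<in> z\<close> by auto
  ultimately show "\<^bold>\<exists> \<^bold>\<diamond> \<psi> \<in> x"
    using assms closed_theory_mp world_closed by blast
qed (use assms in auto)

end

section \<open>The canonical frames of the two logics\<close>

text \<open>The variables of \<open>bd k\<close> have index at most k, so the next variable can be
  interpreted freely.\<close>

lemma subst_bd_upd: "k < i \<Longrightarrow> subst (\<sigma>(i := \<theta>)) (bd k) = subst \<sigma> (bd k)"
  by (induction k rule: bd.induct) auto

context monadic_logic
begin

text \<open>The dummy value \<open>bd 0 = Bot\<close> lets one equation cover both clauses of
  \<open>bd\<close>.\<close>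

lemma bd_Suc_mem:
  "x \<in> worlds \<Longrightarrow> subst \<sigma> (bd (Suc k)) \<in> x \<longleftrightarrow>
    (\<forall>y\<in>worlds. access Mod x y \<longrightarrow> \<^bold>\<box> \<sigma> (Suc k) \<in> y \<longrightarrow> subst \<sigma> (bd k) \<in> y \<or> \<sigma> (Suc k) \<in> x)"
  by (cases k) auto

end

section \<open>The GL side: the canonical relation is a strict order of bounded depth\<close>

locale gl_logic = monadic_logic +
  fixes n :: nat
  assumes GL_axiom: "\<^bold>\<box> (\<^bold>\<box> Var 0 \<^bold>\<rightarrow> Var 0) \<^bold>\<rightarrow> \<^bold>\<box> Var 0 \<in> L"
    and bd_axiom: "bd n \<in> L"
begin

text \<open>Loeb's axiom as an induction rule. Contrapositively, if \<phi> fails at a successor of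
  x, it fails at one that satisfies \<box>\<phi>, a last failure.\<close>

lemma GL_mem:
  assumes "x \<in> worlds" "z \<in> worlds" "access Mod x z"
    and "\<And>y. y \<in> worlds \<Longrightarrow> access Mod x y \<Longrightarrow> \<^bold>\<box> \<phi> \<in> y \<Longrightarrow> \<phi> \<in> y"
  shows "\<phi> \<in> z"
proof -
  have "\<^bold>\<box> (\<^bold>\<box> \<phi> \<^bold>\<rightarrow> \<phi>) \<^bold>\<rightarrow> \<^bold>\<box> \<phi> \<in> x"
    using instance_mem[OF GL_axiom \<open>x \<in> worlds\<close>, of "\<lambda>_. \<phi>"] by simp
  moreover have "\<^bold>\<box> (\<^bold>\<box> \<phi> \<^bold>\<rightarrow> \<phi>) \<in> x"
    unfolding Box_mem_world[OF \<open>x \<in> worlds\<close>] using assms(4) by simp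
  ultimately have "\<^bold>\<box> \<phi> \<in> x"
    using assms closed_theory_mp world_closed by blast
  then show ?thesis
    using assms unfolding access_def by blast
qed

lemma R_trans:
  assumes W: "x \<in> worlds" "y \<in> worlds" "z \<in> worlds" and R: "access Mod x y" "access Mod y z"
  shows "access Mod x z"
  unfolding access_def
proof (intro allI impI)
  fix \<phi> assume \<phi>: "\<^bold>\<box> \<phi> \<in> x"
  \<comment> \<open>The classical derivation of transitivity from Loeb's axiom, applied to the
    conjunction of \<phi> and \<box>\<phi>.\<close>
  have "\<phi> \<^bold>\<and> \<^bold>\<box> \<phi> \<in> y"
  proof (rule GL_mem[OF W(1,2) R(1)])
    fix y' assume y': "y' \<in> worlds" "access Mod x y'" "\<^bold>\<box> (\<phi> \<^bold>\<and> \<^bold>\<box> \<phi>) \<in> y'"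
    moreover have "\<phi> \<in> y'"
      using y' \<phi> unfolding access_def by blast
    ultimately show "\<phi> \<^bold>\<and> \<^bold>\<box> \<phi> \<in> y'"
      by auto
  qed
  then show "\<phi> \<in> z"
    using W R by auto
qed

lemma deep_iff: "x \<in> worlds \<Longrightarrow> deep worlds (access Mod) k x \<longleftrightarrow> (Box Mod ^^ k) Bot \<notin> x"
  by (induction k arbitrary: x) auto

text \<open>Depth is definable here: being k deep is the failure of
  \<open>(Box Mod ^^ k) Bot\<close>. These formulas are substituted into \<open>bd\<close>, with the
  exponent one below the index of the variable.\<close>

lemma bd_notin_deep:
  "x \<in> worlds \<Longrightarrow> deep worlds (access Mod) k x \<Longrightarrow> subst (\<lambda>i. (Box Mod ^^ (i - 1)) Bot) (bd k) \<notin> x"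
proof (induction k arbitrary: x)
  case (Suc k)
  let ?q = "(Box Mod ^^ k) Bot"
  obtain y where y: "y \<in> worlds" "access Mod x y" "?q \<notin> y"
    using Suc.prems deep_iff by auto
  \<comment> \<open>The point y need not satisfy \<box>q; a last failure of q above x does, as the
    instance of \<open>bd\<close> requires.\<close>
  then obtain z where z: "z \<in> worlds" "access Mod x z" "\<^bold>\<box> ?q \<in> z" "?q \<notin> z"
    using GL_mem[OF Suc.prems(1) y(1,2)] by metis
  have "?q \<notin> x"
    using deep_iff[OF Suc.prems(1)] deep_SucD[OF Suc.prems(2)] by simp
  moreover have "subst (\<lambda>i. (Box Mod ^^ (i - 1)) Bot) (bd k) \<notin> z"
    using Suc.IH[OF z(1)] deep_iff[OF z(1)] z(4) by simp
  ultimately show ?case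
    unfolding bd_Suc_mem[OF Suc.prems(1)] using z by auto
qed simp

sublocale frame: monadic_frame worlds "access Mod" E n
proof
  show "\<not> deep worlds (access Mod) n x" if "x \<in> worlds" for x
    using bd_notin_deep[OF that] instance_mem[OF bd_axiom that] by blast
qed (use R_trans E_refl E_sym E_trans E_commute in blast)+

lemma plus_translation_mem:
  assumes "\<phi> \<in> frame_logic worlds frame.weak"
  shows "plus_translation \<phi> \<in> L"
  unfolding mem_L_iff
proof
  fix x assume x: "x \<in> worlds"
  have "sat worlds access (\<lambda>i x. Var i \<in> x) x (plus_translation \<phi>) \<longleftrightarrow>
      sat worlds frame.strict (\<lambda>i x. Var i \<in> x) x (plus_translation \<phi>)"
    by (rule sat_cong) (auto split: modality.split simp: x)
  then show "plus_translation \<phi> \<in> x"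
    using assms x by (simp add: sat_canonical frame.sat_plus_translation frame_logic_def)
qed

end

section \<open>The Grz side: the canonical relation is a partial order of bounded depth\<close>

locale grz_logic = monadic_logic +
  fixes n :: nat
  assumes Grz_axiom: "\<^bold>\<box> (\<^bold>\<box> (Var 0 \<^bold>\<rightarrow> \<^bold>\<box> Var 0) \<^bold>\<rightarrow> Var 0) \<^bold>\<rightarrow> Var 0 \<in> L"
    and Cas_axiom: "Cas \<in> L"
    and bd_axiom: "bd n \<in> L"
begin

abbreviation R where "R \<equiv> access Mod"

text \<open>Packages the Grzegorczyk axiom as the rule from which reflexivity, transitivity and
  antisymmetry of R are all drawn.\<close>

lemma Grz_mem:
  assumes x: "x \<in> worlds"
    and prem: "\<And>y. \<lbrakk>y \<in> worlds; R x y; \<And>z. \<lbrakk>z \<in> worlds; R y z; \<phi> \<in> z\<rbrakk> \<Longrightarrow> \<^bold>\<box> \<phi> \<in> z\<rbrakk> \<Longrightarrow> \<phi> \<in> y"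
  shows "\<phi> \<in> x"
proof -
  have "\<^bold>\<box> (\<^bold>\<box> (\<phi> \<^bold>\<rightarrow> \<^bold>\<box> \<phi>) \<^bold>\<rightarrow> \<phi>) \<^bold>\<rightarrow> \<phi> \<in> x"
    using instance_mem[OF Grz_axiom x, of "\<lambda>_. \<phi>"] by simp
  moreover have "\<^bold>\<box> (\<^bold>\<box> (\<phi> \<^bold>\<rightarrow> \<^bold>\<box> \<phi>) \<^bold>\<rightarrow> \<phi>) \<in> x"
    unfolding Box_mem_world[OF x]
  proof (intro ballI impI)
    fix y assume y: "y \<in> worlds" "R x y"
    have "\<phi> \<in> y" if "\<^bold>\<box> (\<phi> \<^bold>\<rightarrow> \<^bold>\<box> \<phi>) \<in> y"
    proof (rule prem[OF y])
      fix z assume "z \<in> worlds" "R y z" "\<phi> \<in> z"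
      then show "\<^bold>\<box> \<phi> \<in> z"
        using that closed_theory_mp[OF world_closed] unfolding access_def by blast
    qed
    then show "\<^bold>\<box> (\<phi> \<^bold>\<rightarrow> \<^bold>\<box> \<phi>) \<^bold>\<rightarrow> \<phi> \<in> y"
      unfolding Imp_mem_world[OF y(1), of "\<^bold>\<box> (\<phi> \<^bold>\<rightarrow> \<^bold>\<box> \<phi>)"] by blast
  qed
  ultimately show ?thesis
    using closed_theory_mp[OF world_closed[OF x]] by blast
qed

lemma R_refl: "x \<in> worlds \<Longrightarrow> R x x"
  unfolding access_def
proof (intro allI impI)
  fix \<phi> assume "x \<in> worlds" "\<^bold>\<box> \<phi> \<in> x"
  then show "\<phi> \<in> x"
    using Grz_mem unfolding access_def by blast
qed

lemma R_trans:
  assumes W: "x \<in> worlds" "y \<in> worlds" "z \<in> worlds" and R: "R x y" "R y z"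
  shows "R x z"
  unfolding access_def
proof (intro allI impI)
  fix \<phi> assume \<phi>: "\<^bold>\<box> \<phi> \<in> x"
  \<comment> \<open>The known formula by which the Grzegorczyk axiom yields transitivity.\<close>
  let ?q = "\<phi> \<^bold>\<and> (\<^bold>\<box> \<phi> \<^bold>\<rightarrow> \<^bold>\<box> \<^bold>\<box> \<phi>)"
  have q_iff: "?q \<in> u \<longleftrightarrow> \<phi> \<in> u \<and> (\<^bold>\<box> \<phi> \<in> u \<longrightarrow> \<^bold>\<box> \<^bold>\<box> \<phi> \<in> u)" if "u \<in> worlds" for u
    using that by auto
  have "?q \<in> x"
  proof (rule Grz_mem[OF W(1)])
    fix u assume u: "u \<in> worlds" "R x u"
      and hered: "\<And>v. \<lbrakk>v \<in> worlds; R u v; ?q \<in> v\<rbrakk> \<Longrightarrow> \<^bold>\<box> ?q \<in> v"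
    \<comment> \<open>If \<box>\<phi> failed at v, then q would hold there vacuously in its second
      conjunct; its persistence gives \<box>q and hence \<box>\<phi> at v.\<close>
    have "\<^bold>\<box> \<phi> \<in> v" if "\<^bold>\<box> \<phi> \<in> u" and v: "v \<in> worlds" "R u v" for v
    proof (rule ccontr)
      assume "\<^bold>\<box> \<phi> \<notin> v"
      moreover have "\<phi> \<in> v"
        using that unfolding access_def by blast
      ultimately have "?q \<in> v"
        using q_iff v by blast
      then have "\<^bold>\<box> ?q \<in> v"
        using hered v by blast
      then have "\<^bold>\<box> \<phi> \<in> v"
        unfolding Box_mem_world[OF v(1)] using q_iff by blast
      then show False
        using \<open>\<^bold>\<box> \<phi> \<notin> v\<close> by contradiction
    qed
    moreover have "\<phi> \<in> u"
      using \<phi> u unfolding access_def by blast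
    ultimately show "?q \<in> u"
      unfolding q_iff[OF u(1)] Box_mem_world[OF u(1), of Mod "\<^bold>\<box> \<phi>"] by blast
  qed
  then have "\<^bold>\<box> \<^bold>\<box> \<phi> \<in> x"
    using \<phi> q_iff W by blast
  then show "\<phi> \<in> z"
    using R unfolding access_def by blast
qed

text \<open>A syntactic measure of depth, over all instances so that each step may choose its own
  separating formula. It is available before antisymmetry and later agrees with
  \<open>deep worlds lt\<close>.\<close>

definition fails :: "nat \<Rightarrow> mform set \<Rightarrow> bool" where
  "fails k x \<longleftrightarrow> (\<exists>\<sigma>. subst \<sigma> (bd k) \<notin> x)"

text \<open>A formula \<theta> witnessing \<open>\<not> R y x\<close> interprets the new variable;
  the instance of \<open>bd k\<close> failing at y is unaffected.\<close>

lemma fails_SucI: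
  assumes W: "x \<in> worlds" "y \<in> worlds" and "R x y" "\<not> R y x" "fails k y"
  shows "fails (Suc k) x"
proof -
  obtain \<theta> where \<theta>: "\<^bold>\<box> \<theta> \<in> y" "\<theta> \<notin> x"
    using \<open>\<not> R y x\<close> by (auto simp: access_def)
  obtain \<sigma> where \<sigma>: "subst \<sigma> (bd k) \<notin> y"
    using \<open>fails k y\<close> by (auto simp: fails_def)
  have "subst (\<sigma>(Suc k := \<theta>)) (bd (Suc k)) \<notin> x"
    unfolding bd_Suc_mem[OF W(1)] subst_bd_upd[OF lessI] fun_upd_same
    using W \<open>R x y\<close> \<theta> \<sigma> by blast
  then show ?thesis
    unfolding fails_def by blast
qed

lemma fails_SucE:
  assumes "x \<in> worlds" "fails (Suc k) x"
  obtains y where "y \<in> worlds" "R x y" "\<not> R y x" "fails k y"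
proof -
  obtain \<sigma> where "subst \<sigma> (bd (Suc k)) \<notin> x"
    using assms by (auto simp: fails_def)
  then obtain y where y: "y \<in> worlds" "R x y" "\<^bold>\<box> \<sigma> (Suc k) \<in> y" "\<sigma> (Suc k) \<notin> x"
      "subst \<sigma> (bd k) \<notin> y"
    unfolding bd_Suc_mem[OF assms(1)] by blast
  have "\<not> R y x"
    using y(3,4) by (auto simp only: access_def)
  moreover have "fails k y"
    using y by (auto simp: fails_def)
  ultimately show thesis
    using that y by blast
qed

lemma not_fails: "x \<in> worlds \<Longrightarrow> \<not> fails n x"
  using instance_mem[OF bd_axiom] by (auto simp: fails_def)

text \<open>With \<open>k\<close> maximal such that some instance \<open>\<chi>\<close> of \<open>bd k\<close> fails at \<open>y\<close>, all points strictly above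
  the cluster of \<open>y\<close> satisfy \<open>\<chi>\<close>, so that the Grzegorczyk axiom for \<open>p \<or> \<chi>\<close> acts within the cluster.\<close>

lemma R_antisym:
  assumes W: "x \<in> worlds" "y \<in> worlds" and R: "R x y" "R y x"
  shows "x = y"
proof (rule worlds_eqI[OF W], rule subsetI, rule ccontr)
  fix p assume p: "p \<in> x" "p \<notin> y"
  \<comment> \<open>Holds because \<open>bd 0\<close> is \<open>Bot\<close>; this starts the search
    for the last failing k.\<close>
  have "fails 0 y"
    using W by (simp add: fails_def)
  then obtain k where k: "fails k y" "\<not> fails (Suc k) y"
    using ex_least_nat_less[of "\<lambda>k. \<not> fails k y" n] not_fails[OF W(2)] by auto
  then obtain \<sigma> where \<sigma>: "subst \<sigma> (bd k) \<notin> y"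
    by (auto simp: fails_def)
  let ?p = "p \<^bold>\<or> subst \<sigma> (bd k)"
  have "?p \<in> y"
  proof (rule Grz_mem[OF W(2)], rule ccontr)
    fix z assume z: "z \<in> worlds" "R y z" "?p \<notin> z"
      and hered: "\<And>u. \<lbrakk>u \<in> worlds; R z u; ?p \<in> u\<rbrakk> \<Longrightarrow> \<^bold>\<box> ?p \<in> u"
    then have "fails k z"
      by (auto simp: fails_def)
    then have "R z y"
      using fails_SucI[OF W(2) z(1,2)] k by blast
    then have "R z x"
      using R_trans z W R by blast
    then have "\<^bold>\<box> ?p \<in> x"
      using hered W p by simp
    then have "?p \<in> y"
      using R unfolding access_def by blast
    then show False
      using W p \<sigma> by simp
  qed
  then show False
    using W p \<sigma> by simp
qed

definition lt :: "mform set \<Rightarrow> mform set \<Rightarrow> bool" where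
  "lt x y \<longleftrightarrow> R x y \<and> x \<noteq> y"

lemma lt_iff: "\<lbrakk>x \<in> worlds; y \<in> worlds\<rbrakk> \<Longrightarrow> lt x y \<longleftrightarrow> R x y \<and> \<not> R y x"
  using R_antisym R_refl by (auto simp: lt_def)

lemma lt_trans: "\<lbrakk>x \<in> worlds; y \<in> worlds; z \<in> worlds; lt x y; R y z\<rbrakk> \<Longrightarrow> lt x z"
  using R_trans lt_iff by meson

lemma fails_iff_deep: "x \<in> worlds \<Longrightarrow> fails k x \<longleftrightarrow> deep worlds lt k x"
proof (induction k arbitrary: x)
  case 0
  then show ?case
    by (simp add: fails_def)
next
  case (Suc k)
  have "fails (Suc k) x \<longleftrightarrow> (\<exists>y\<in>worlds. lt x y \<and> fails k y)"
  proof
    assume "fails (Suc k) x"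
    then obtain y where "y \<in> worlds" "R x y" "\<not> R y x" "fails k y"
      by (rule fails_SucE[OF Suc.prems])
    then show "\<exists>y\<in>worlds. lt x y \<and> fails k y"
      using lt_iff[OF Suc.prems] by blast
  next
    assume "\<exists>y\<in>worlds. lt x y \<and> fails k y"
    then show "fails (Suc k) x"
      using fails_SucI[OF Suc.prems] lt_iff[OF Suc.prems] by blast
  qed
  then show ?case
    using Suc.IH by auto
qed

lemma lt_induct [consumes 1, case_names step]:
  assumes "x \<in> worlds" and "\<And>x. x \<in> worlds \<Longrightarrow> (\<And>y. y \<in> worlds \<Longrightarrow> lt x y \<Longrightarrow> P y) \<Longrightarrow> P x"
  shows "P x"
  using finite_depth_induct[of worlds lt n x P] not_fails fails_iff_deep assms by blast

section \<open>Casari's formula: no world lies strictly below an \<exists>-equivalent one\<close>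

definition Q :: "mform set \<Rightarrow> mform set \<Rightarrow> bool" where
  "Q x z \<longleftrightarrow> (\<exists>y\<in>worlds. R x y \<and> E y z)"

lemma Q_trans: "x \<in> worlds \<Longrightarrow> y \<in> worlds \<Longrightarrow> z \<in> worlds \<Longrightarrow> Q x y \<Longrightarrow> Q y z \<Longrightarrow> Q x z"
proof -
  assume W: "x \<in> worlds" "y \<in> worlds" "z \<in> worlds" and "Q x y" "Q y z"
  then obtain a b where ab: "a \<in> worlds" "b \<in> worlds" "R x a" "E a y" "R y b" "E b z"
    by (auto simp: Q_def)
  then obtain w where w: "w \<in> worlds" "R a w" "E w b"
    using E_commute W by blast
  then have "R x w" "E w z"
    using R_trans E_trans ab W by blast+
  then show "Q x z"
    using w by (auto simp: Q_def)
qed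

lemma R_imp_Q: "\<lbrakk>x \<in> worlds; y \<in> worlds; R x y\<rbrakk> \<Longrightarrow> Q x y"
  using E_refl by (auto simp: Q_def)

lemma E_imp_Q: "\<lbrakk>x \<in> worlds; y \<in> worlds; E x y\<rbrakk> \<Longrightarrow> Q x y"
  using R_refl by (auto simp: Q_def)

lemma box_all_mem: "x \<in> worlds \<Longrightarrow> \<^bold>\<box> \<^bold>\<forall> \<phi> \<in> x \<longleftrightarrow> (\<forall>t\<in>worlds. Q x t \<longrightarrow> \<phi> \<in> t)"
  unfolding Q_def by (simp add: Box_mem_world del: Imp_mem_world Dia_mem_world) blast

text \<open>The condition under which \<open>commute\<close> passes from R to \<open>lt\<close>; the
  lemmas below establish it for every world.\<close>

definition clean :: "mform set \<Rightarrow> bool" where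
  "clean x \<longleftrightarrow> (\<forall>y\<in>worlds. E x y \<longrightarrow> \<not> lt x y)"

text \<open>A strict step from t to s is copied by \<open>E_commute\<close> to a step from t' to s'.
  It stays strict: s' = t' would make t and s E-related, against t being clean.\<close>

lemma fails_E_invariant:
  assumes "t \<in> worlds" "t' \<in> worlds" "E t t'" "fails k t"
    and "\<And>s. s \<in> worlds \<Longrightarrow> Q t s \<Longrightarrow> clean s"
  shows "fails k t'"
  using assms
proof (induction k arbitrary: t t')
  case 0
  then show ?case
    by (simp add: fails_def)
next
  case (Suc k)
  then obtain s where s: "s \<in> worlds" "R t s" "\<not> R s t" "fails k s"
    using fails_SucE by blast
  have "lt t s"
    using s Suc.prems lt_iff by blast
  obtain s' where s': "s' \<in> worlds" "R t' s'" "E s' s"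
    using E_commute[of t' t s] E_sym Suc.prems s by blast
  have "Q t s"
    using R_imp_Q s Suc.prems by blast
  have "fails k s'"
  proof (rule Suc.IH[OF s(1) s'(1) _ s(4)])
    show "E s s'"
      using E_sym s s' by blast
    show "clean u" if "u \<in> worlds" "Q s u" for u
      using Suc.prems(5)[OF that(1)] Q_trans[OF Suc.prems(1) s(1) that(1)] \<open>Q t s\<close> that by blast
  qed
  moreover have "\<not> R s' t'"
  proof
    assume "R s' t'"
    then have "s' = t'"
      using R_antisym s' Suc.prems by blast
    then have "E t s"
      using E_trans[of t t' s] s s' Suc.prems by blast
    moreover have "clean t"
      using Suc.prems E_imp_Q E_refl by blast
    ultimately show False
      using \<open>lt t s\<close> s by (auto simp: clean_def)
  qed
  ultimately show ?case
    using fails_SucI s' Suc.prems by blast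
qed

text \<open>The premise refutes the inner antecedent of \<open>Cas\<close> wherever \<box>\<forall>p
  fails, which makes the outer antecedent true at y.\<close>

lemma Cas_mem:
  assumes y: "y \<in> worlds"
    and prem: "\<And>v. \<lbrakk>v \<in> worlds; Q y v; \<^bold>\<box> \<^bold>\<forall> p \<notin> v\<rbrakk> \<Longrightarrow>
      \<exists>u\<in>worlds. R v u \<and> \<^bold>\<box> p \<in> u \<and> \<^bold>\<box> \<^bold>\<forall> p \<notin> u"
  shows "p \<in> y"
proof -
  let ?C = "\<^bold>\<box> \<^bold>\<forall> p" and ?D = "\<^bold>\<box> (\<^bold>\<box> p \<^bold>\<rightarrow> \<^bold>\<box> \<^bold>\<forall> p)"
  have "\<^bold>\<box> \<^bold>\<forall> (?D \<^bold>\<rightarrow> ?C) \<^bold>\<rightarrow> ?C \<in> y"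
    using instance_mem[OF Cas_axiom y, of "\<lambda>_. p"] by (simp add: Cas_def del: Imp_mem_world Dia_mem_world)
  moreover have "\<^bold>\<box> \<^bold>\<forall> (?D \<^bold>\<rightarrow> ?C) \<in> y"
    unfolding box_all_mem[OF y]
  proof (intro ballI impI)
    fix v assume v: "v \<in> worlds" "Q y v"
    have "?D \<notin> v" if C: "?C \<notin> v"
    proof
      assume "?D \<in> v"
      moreover obtain u where u: "u \<in> worlds" "R v u" "\<^bold>\<box> p \<in> u" "?C \<notin> u"
        using prem[OF v C] by blast
      ultimately have "\<^bold>\<box> p \<^bold>\<rightarrow> ?C \<in> u"
        unfolding access_def by blast
      then show False
        using closed_theory_mp[OF world_closed] u by blast
    qed
    then show "?D \<^bold>\<rightarrow> ?C \<in> v"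
      unfolding Imp_mem_world[OF v(1), of ?D] by blast
  qed
  ultimately have "?C \<in> y"
    using closed_theory_mp[OF world_closed[OF y]] by blast
  moreover have "Q y y"
    using E_imp_Q E_refl y by blast
  ultimately show ?thesis
    using box_all_mem y by blast
qed

text \<open>Climb along \<open>lt\<close> while y stays Q-reachable; finite depth ends the
  climb.\<close>

lemma last_in_cluster:
  assumes "w \<in> worlds" "Q w y" "y \<in> worlds"
  shows "\<exists>u\<in>worlds. R w u \<and> Q u y \<and> (\<forall>v\<in>worlds. lt u v \<longrightarrow> \<not> Q v y)"
  using assms(1,2)
proof (induction rule: lt_induct)
  case (step w)
  show ?case
  proof (cases "\<exists>v\<in>worlds. lt w v \<and> Q v y")
    case True
    then obtain v u where "v \<in> worlds" "lt w v" "u \<in> worlds" "R v u" "Q u y"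
        "\<forall>v\<in>worlds. lt u v \<longrightarrow> \<not> Q v y"
      using step.IH by meson
    then show ?thesis
      using R_trans[of w v u] step.hyps by (auto simp: lt_def)
  next
    case False
    then show ?thesis
      using step R_refl by blast
  qed
qed

text \<open>Casari's formula is used for an instance \<open>p\<close> of \<open>bd k\<close> failing at \<open>y\<close>, where \<open>k\<close> is the depth
  (counted from 1) of the \<open>R\<close>-last points of the \<open>Q\<close>-cluster of \<open>y\<close>. These all have the same depth,
  since depth is \<open>E\<close>-invariant strictly above the cluster.\<close>

lemma clean_step:
  assumes y: "y \<in> worlds"
    and above: "\<And>t. t \<in> worlds \<Longrightarrow> Q y t \<Longrightarrow> \<not> Q t y \<Longrightarrow> clean t"
  shows "clean y"
proof (rule ccontr)
  assume "\<not> clean y"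
  then obtain z where z: "z \<in> worlds" "E y z" "lt y z"
    by (auto simp: clean_def)
  define last where "last u \<longleftrightarrow> u \<in> worlds \<and> Q y u \<and> Q u y \<and> (\<forall>v\<in>worlds. lt u v \<longrightarrow> \<not> Q v y)" for u
  have Qyz: "Q y z" "Q z y"
    using E_imp_Q E_sym y z by blast+
  have strictly_above: "fails k t'"
    if "t \<in> worlds" "t' \<in> worlds" "E t t'" "fails k t" "Q y t" "\<not> Q t y" for k t t'
  proof (rule fails_E_invariant[OF that(1-4)])
    fix s assume s: "s \<in> worlds" "Q t s"
    show "clean s"
      using above[OF s(1)] Q_trans[OF y that(1) s(1)] Q_trans[OF that(1) s(1) y] s that by blast
  qed
  \<comment> \<open>A Q-step from the cluster to t splits into an R-step to t' and an E-step; depth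
    passes from t to t' because everything from t on is clean.\<close>
  have reach: "\<exists>t'\<in>worlds. R u t' \<and> u \<noteq> t' \<and> fails k t'"
    if u: "u \<in> worlds" "Q y u" "Q u y" and t: "t \<in> worlds" "Q y t" "\<not> Q t y" "fails k t" for u t k
  proof -
    have "Q u t"
      using Q_trans u t y by blast
    then obtain t' where t': "t' \<in> worlds" "R u t'" "E t' t"
      by (auto simp: Q_def)
    have "fails k t'"
      using strictly_above[of t t' k] t t' E_sym by blast
    moreover have "u \<noteq> t'"
    proof
      assume "u = t'"
      then have "Q t u"
        using E_imp_Q[OF t(1) u(1)] E_sym[OF u(1) t(1)] t'(3) by simp
      then show False
        using Q_trans[OF t(1) u(1) y] u(3) t(3) by blast
    qed
    ultimately show ?thesis
      using t' by blast
  qed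
  \<comment> \<open>The points strictly above a last point have left the cluster, and
    \<open>reach\<close> finds equally deep ones above any other last point.\<close>
  have same: "fails k u'" if h: "last u" "last u'" "fails k u" for k u u'
  proof (cases k)
    case 0
    then show ?thesis
      using h by (auto simp: fails_def last_def)
  next
    case (Suc j)
    then obtain t where t: "t \<in> worlds" "R u t" "\<not> R t u" "fails j t"
      using fails_SucE[of u j] h unfolding last_def by blast
    have "Q y t"
      using Q_trans[of y u t] R_imp_Q[of u t] t y h by (auto simp: last_def)
    moreover have "\<not> Q t y"
      using t lt_iff[of u t] h unfolding last_def by blast
    ultimately obtain t' where "t' \<in> worlds" "R u' t'" "u' \<noteq> t'" "fails j t'"
      using reach[of u' t j] t h unfolding last_def by blast
    then show ?thesis
      using fails_SucI[of u' t' j] R_antisym[of u' t'] h Suc unfolding last_def by blast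
  qed
  have last_above: "\<exists>u. last u \<and> R w u" if h: "w \<in> worlds" "Q y w" "Q w y" for w
  proof -
    obtain u where u: "u \<in> worlds" "R w u" "Q u y" "\<forall>v\<in>worlds. lt u v \<longrightarrow> \<not> Q v y"
      using last_in_cluster[OF h(1,3) y] by blast
    moreover have "Q y u"
      using Q_trans[OF y h(1) u(1)] R_imp_Q u h by blast
    ultimately show ?thesis
      by (auto simp: last_def)
  qed
  obtain u where u: "last u" "R z u"
    using last_above Qyz z by blast
  then have uW: "u \<in> worlds" "Q y u" "Q u y"
    by (auto simp: last_def)
  have "fails 0 u"
    using uW by (simp add: fails_def)
  \<comment> \<open>k counts the strict steps available from u, so the depth of u in points is
    \<open>Suc k\<close>; hence the index of the formula p below.\<close>
  then obtain k where k: "fails k u" "\<not> fails (Suc k) u"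
    using ex_least_nat_less[of "\<lambda>k. \<not> fails k u" n] not_fails[OF uW(1)] by auto
  \<comment> \<open>Since z lies strictly above y and u above z, y is deeper than u. So an instance
    of \<open>bd (Suc k)\<close> fails at y although none fails at u.\<close>
  have "lt y u"
    using lt_trans z u uW y by blast
  then have "fails (Suc k) y"
    using fails_SucI[OF y uW(1)] k lt_iff y uW by blast
  then obtain \<sigma> where \<sigma>: "subst \<sigma> (bd (Suc k)) \<notin> y"
    by (auto simp: fails_def)
  define p where "p = subst \<sigma> (bd (Suc k))"
  \<comment> \<open>A failure of p outside the cluster would be reflected by \<open>reach\<close>
    strictly above u, making u too deep.\<close>
  have p_above: "p \<in> t" if t: "t \<in> worlds" "Q y t" "\<not> Q t y" for t
  proof (rule ccontr)
    assume "p \<notin> t"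
    then have "fails (Suc k) t"
      by (auto simp: fails_def p_def)
    then obtain t' where t': "t' \<in> worlds" "R u t'" "u \<noteq> t'" "fails (Suc k) t'"
      using reach[OF uW t] by blast
    then have "fails (Suc (Suc k)) u"
      using fails_SucI[of u t'] R_antisym[of u t'] uW by blast
    then have "fails (Suc k) u"
      using deep_SucD fails_iff_deep[OF uW(1)] by metis
    then show False
      using k by blast
  qed
  have p_last: "\<^bold>\<box> p \<in> w" if "last w" for w
  proof -
    have w: "w \<in> worlds" "Q y w"
      using that by (auto simp: last_def)
    have "p \<in> w"
      using same[OF that u(1)] k by (auto simp: p_def fails_def)
    moreover have "p \<in> v" if v: "v \<in> worlds" "lt w v" for v
    proof (rule p_above[OF v(1)])
      show "Q y v"
        using Q_trans[OF y w(1) v(1) w(2)] R_imp_Q[OF w(1) v(1)] v by (simp add: lt_def)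
      show "\<not> Q v y"
        using \<open>last w\<close> v by (simp add: last_def)
    qed
    ultimately show ?thesis
      unfolding Box_mem_world[OF w(1)] lt_def by blast
  qed
  have "p \<in> y"
  proof (rule Cas_mem[OF y])
    fix v assume v: "v \<in> worlds" "Q y v" "\<^bold>\<box> \<^bold>\<forall> p \<notin> v"
    \<comment> \<open>Outside the cluster p holds at everything Q-reachable, so a v refuting
      \<box>\<forall>p lies inside.\<close>
    have "Q v y"
    proof (rule ccontr)
      assume "\<not> Q v y"
      then have "p \<in> t" if "t \<in> worlds" "Q v t" for t
        using p_above[OF that(1)] Q_trans[OF y v(1) that(1)] Q_trans[OF v(1) that(1) y] v that by blast
      then show False
        using v box_all_mem by blast
    qed
    then obtain w where w: "last w" "R v w"
      using last_above v by blast
    \<comment> \<open>The last point w satisfies \<box>p but still Q-sees y, where p fails: it is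
      the witness that Casari's formula asks for.\<close>
    moreover have "\<^bold>\<box> \<^bold>\<forall> p \<notin> w"
      using box_all_mem[of w p] w y \<sigma> by (auto simp: last_def p_def)
    ultimately show "\<exists>w\<in>worlds. R v w \<and> \<^bold>\<box> p \<in> w \<and> \<^bold>\<box> \<^bold>\<forall> p \<notin> w"
      using p_last unfolding last_def by blast
  qed
  then show False
    using \<sigma> by (simp add: p_def)
qed

text \<open>The induction runs over whole E-classes because Q-steps do: a t that is Q-above y but
  not below it is E-related to some x' strictly above x, so the hypothesis for x' covers t.\<close>

lemma clean_class: "x \<in> worlds \<Longrightarrow> \<forall>y\<in>worlds. E x y \<longrightarrow> clean y"
proof (induction rule: lt_induct)
  case (step x)
  show ?case
  proof (intro ballI impI)
    fix y assume y: "y \<in> worlds" "E x y"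
    show "clean y"
    proof (rule clean_step[OF y(1)])
      fix t assume t: "t \<in> worlds" "Q y t" "\<not> Q t y"
      have "Q x t"
        using Q_trans[OF step.hyps y(1) t(1)] E_imp_Q[OF step.hyps y(1)] y t by blast
      then obtain x' where x': "x' \<in> worlds" "R x x'" "E x' t"
        by (auto simp: Q_def)
      have "x \<noteq> x'"
      proof
        assume "x = x'"
        then have "E t y"
          using E_sym[OF step.hyps t(1)] E_trans[OF t(1) step.hyps y(1)] x'(3) y(2) by blast
        then show False
          using E_imp_Q t y by blast
      qed
      then show "clean t"
        using step.IH[of x'] x' t by (auto simp: lt_def)
    qed
  qed
qed

lemma not_lt_E: "\<lbrakk>x \<in> worlds; y \<in> worlds; E x y\<rbrakk> \<Longrightarrow> \<not> lt x y"
  using clean_class E_refl by (auto simp: clean_def)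

sublocale frame: monadic_frame worlds lt E n
proof
  show "\<exists>w\<in>worlds. lt x w \<and> E w z"
    if W: "x \<in> worlds" "y \<in> worlds" "z \<in> worlds" and h: "E x y" "lt y z" for x y z
  proof -
    obtain w where w: "w \<in> worlds" "R x w" "E w z"
      using E_commute[OF W] h by (auto simp: lt_def)
    \<comment> \<open>If x = w, then y and z are E-related through x, although z lies strictly above
      y.\<close>
    have "x \<noteq> w"
      using not_lt_E[OF W(2,3)] E_trans[OF W(2,1,3)] E_sym[OF W(1,2)] h w by blast
    then show ?thesis
      using w by (auto simp: lt_def)
  qed
  show "lt x z" if "x \<in> worlds" "y \<in> worlds" "z \<in> worlds" "lt x y" "lt y z" for x y z
    using lt_trans that unfolding lt_def[of y z] by blast
  show "\<not> deep worlds lt n x" if "x \<in> worlds" for x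
    using not_fails fails_iff_deep that by blast
qed (use E_refl E_sym E_trans in blast)+

lemma mem_if_plus_translation:
  assumes "plus_translation \<phi> \<in> frame_logic worlds frame.strict"
  shows "\<phi> \<in> L"
  unfolding mem_L_iff
proof
  fix x assume x: "x \<in> worlds"
  have "sat worlds access (\<lambda>i x. Var i \<in> x) x \<phi> \<longleftrightarrow>
      sat worlds frame.weak (\<lambda>i x. Var i \<in> x) x \<phi>"
    by (rule sat_cong) (auto split: modality.split simp: x lt_def R_refl)
  then show "\<phi> \<in> x"
    using assms x by (simp add: sat_canonical frame.sat_plus_translation frame_logic_def)
qed

end

section \<open>The logics of the theorem\<close>

instance modality :: countable
  by countable_datatype

lemma le_extension: "M \<subseteq> M \<^bold>+ \<alpha>" and mem_extension: "\<alpha> \<in> M \<^bold>+ \<alpha>"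
  by (auto simp: extension_def intro: logic_closure.base)

lemma K_le_GL: "K \<subseteq> GL" and K_le_Grz: "K \<subseteq> Grz"
  unfolding GL_def Grz_def by (rule le_extension)+

lemma K_le_S5: "K \<subseteq> S5"
  unfolding S5_def using le_extension by blast

lemma S5_axioms:
  "\<box> Var 0 \<^bold>\<rightarrow> Var 0 \<in> S5" "\<box> Var 0 \<^bold>\<rightarrow> \<box> \<box> Var 0 \<in> S5" "Var 0 \<^bold>\<rightarrow> \<box> \<diamond> Var 0 \<in> S5"
  unfolding S5_def using le_extension mem_extension by blast+

lemma map_form_le_monadic:
  "map_form (\<lambda>_. Mod) ` U \<subseteq> monadic U" "map_form (\<lambda>_. Qua) ` S5 \<subseteq> monadic U"
  unfolding monadic_def fusion_def
  by (rule order_trans[OF _ le_extension], blast intro: logic_closure.base)+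

text \<open>The laws of \<diamond> are inherited from \<open>K \<subseteq> U\<close>, those of
  \<exists> from S5, each by renaming the single modality.\<close>

lemma monadic_logic_closure:
  assumes "K \<subseteq> U" and le: "monadic U \<subseteq> logic_closure A"
  shows "monadic_logic (logic_closure A)"
proof -
  let ?L = "logic_closure A"
  have Mod: "map_form (\<lambda>_. Mod) \<phi> \<in> ?L" if "\<phi> \<in> K" for \<phi>
    using that assms map_form_le_monadic(1)[of U] by blast
  have Qua: "map_form (\<lambda>_. Qua) \<phi> \<in> ?L" if "\<phi> \<in> S5" for \<phi>
    using that le map_form_le_monadic(2)[of U] by blast
  have K_axioms: "\<box> (Var 0 \<^bold>\<rightarrow> Var 1) \<^bold>\<rightarrow> \<box> Var 0 \<^bold>\<rightarrow> \<box> Var 1 \<in> K"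
      "(\<diamond> Var 0 \<^bold>\<leftrightarrow> \<^bold>\<not> \<box> \<^bold>\<not> Var 0) \<in> K"
    unfolding K_def by (auto intro: logic_closure.base)
  show ?thesis
  proof
    show "tautologies \<subseteq> ?L"
    proof
      fix \<phi> :: mform assume "\<phi> \<in> tautologies"
      \<comment> \<open>\<open>K\<close> supplies the coded tautology; substituting along
        \<open>from_nat\<close> restores the original atoms.\<close>
      then have "abstract_atoms \<phi> \<in> K"
        unfolding K_def
        by (intro logic_closure.base) (simp add: tautologies_def ptrue_abstract_atoms)
      then have "subst from_nat (map_form (\<lambda>_. Mod) (abstract_atoms \<phi>)) \<in> ?L"
        using Mod logic_closure.substitution by blast
      then show "\<phi> \<in> ?L"
        by (simp add: subst_abstract_atoms)
    qed
    show "Box m (Var 0 \<^bold>\<rightarrow> Var 1) \<^bold>\<rightarrow> Box m (Var 0) \<^bold>\<rightarrow> Box m (Var 1) \<in> ?L" for m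
      using Mod[OF K_axioms(1)] Qua[OF subsetD[OF K_le_S5 K_axioms(1)]] by (cases m) simp_all
    show "(Dia m (Var 0) \<^bold>\<leftrightarrow> \<^bold>\<not> Box m (\<^bold>\<not> Var 0)) \<in> ?L" for m
      using Mod[OF K_axioms(2)] Qua[OF subsetD[OF K_le_S5 K_axioms(2)]] by (cases m) simp_all
    show "\<^bold>\<forall> Var 0 \<^bold>\<rightarrow> Var 0 \<in> ?L" "\<^bold>\<forall> Var 0 \<^bold>\<rightarrow> \<^bold>\<forall> \<^bold>\<forall> Var 0 \<in> ?L"
        "Var 0 \<^bold>\<rightarrow> \<^bold>\<forall> \<^bold>\<exists> Var 0 \<in> ?L"
      using Qua[OF S5_axioms(1)] Qua[OF S5_axioms(2)] Qua[OF S5_axioms(3)] by simp_all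
    show "\<^bold>\<exists> \<^bold>\<diamond> Var 0 \<^bold>\<rightarrow> \<^bold>\<diamond> \<^bold>\<exists> Var 0 \<in> ?L"
      using le mem_extension unfolding monadic_def by blast
  qed (auto intro: logic_closure.intros)
qed

lemma gl_logic_closure:
  assumes le: "monadic GL \<subseteq> logic_closure A" and bd: "bd n \<in> logic_closure A"
  shows "gl_logic (logic_closure A) n"
proof -
  interpret monadic_logic "logic_closure A"
    using K_le_GL le by (rule monadic_logic_closure)
  have "\<box> (\<box> Var 0 \<^bold>\<rightarrow> Var 0) \<^bold>\<rightarrow> \<box> Var 0 \<in> GL"
    unfolding GL_def by (rule mem_extension)
  then have "map_form (\<lambda>_. Mod) (\<box> (\<box> Var 0 \<^bold>\<rightarrow> Var 0) \<^bold>\<rightarrow> \<box> Var 0) \<in> logic_closure A"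
    using le map_form_le_monadic(1)[of GL] by blast
  then show ?thesis
    using bd by unfold_locales simp_all
qed

lemma grz_logic_closure:
  assumes le: "monadic Grz \<subseteq> logic_closure A" and "Cas \<in> logic_closure A" "bd n \<in> logic_closure A"
  shows "grz_logic (logic_closure A) n"
proof -
  interpret monadic_logic "logic_closure A"
    using K_le_Grz le by (rule monadic_logic_closure)
  have "\<box> (\<box> (Var 0 \<^bold>\<rightarrow> \<box> Var 0) \<^bold>\<rightarrow> Var 0) \<^bold>\<rightarrow> Var 0 \<in> Grz"
    unfolding Grz_def by (rule mem_extension)
  then have "map_form (\<lambda>_. Mod) (\<box> (\<box> (Var 0 \<^bold>\<rightarrow> \<box> Var 0) \<^bold>\<rightarrow> Var 0) \<^bold>\<rightarrow> Var 0) \<in> logic_closure A"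
    using le map_form_le_monadic(1)[of Grz] by blast
  then show ?thesis
    using assms(2,3) by unfold_locales simp_all
qed

lemma gl_logic_MGL: "gl_logic MGL\<^bold>[n\<^bold>] n"
  unfolding finite_depth_def extension_def
  by (rule gl_logic_closure; fold extension_def)
    (use le_extension mem_extension in \<open>auto simp: MGL_def\<close>)

lemma gl_logic_MGLB: "gl_logic MGLB\<^bold>[n\<^bold>] n"
proof -
  have "monadic GL \<subseteq> MGLB \<^bold>+ bd n"
    unfolding MGLB_def monadicB_def using le_extension by blast
  then show ?thesis
    unfolding finite_depth_def extension_def
    by (rule gl_logic_closure; fold extension_def) (rule mem_extension)
qed

lemma grz_logic_MplusGrz: "grz_logic MplusGrz\<^bold>[n\<^bold>] n"
proof -
  have "monadic Grz \<subseteq> MplusGrz \<^bold>+ bd n" "Cas \<in> MplusGrz \<^bold>+ bd n"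
    unfolding MplusGrz_def MGrz_def using le_extension mem_extension by blast+
  then show ?thesis
    unfolding finite_depth_def extension_def
    by (rule grz_logic_closure; fold extension_def) (rule mem_extension)
qed

lemma grz_logic_MplusGrzB: "grz_logic MplusGrzB\<^bold>[n\<^bold>] n"
proof -
  have "monadic Grz \<subseteq> MplusGrzB \<^bold>+ bd n" "Cas \<in> MplusGrzB \<^bold>+ bd n"
    unfolding MplusGrzB_def MGrzB_def monadicB_def using le_extension mem_extension by blast+
  then show ?thesis
    unfolding finite_depth_def extension_def
    by (rule grz_logic_closure; fold extension_def) (rule mem_extension)
qed

lemma barcan_mem:
  "\<^bold>\<diamond> \<^bold>\<exists> Var 0 \<^bold>\<rightarrow> \<^bold>\<exists> \<^bold>\<diamond> Var 0 \<in> MGLB\<^bold>[n\<^bold>]"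
  "\<^bold>\<diamond> \<^bold>\<exists> Var 0 \<^bold>\<rightarrow> \<^bold>\<exists> \<^bold>\<diamond> Var 0 \<in> MplusGrzB\<^bold>[n\<^bold>]"
  unfolding finite_depth_def MGLB_def MplusGrzB_def MGrzB_def monadicB_def
  using le_extension mem_extension by blast+

lemma (in gl_logic) barcan_frame:
  assumes "\<^bold>\<diamond> \<^bold>\<exists> Var 0 \<^bold>\<rightarrow> \<^bold>\<exists> \<^bold>\<diamond> Var 0 \<in> L"
  shows "monadic_barcan_frame worlds (access Mod) E n"
  by unfold_locales (rule E_barcan[OF assms])

lemma (in grz_logic) barcan_frame:
  assumes "\<^bold>\<diamond> \<^bold>\<exists> Var 0 \<^bold>\<rightarrow> \<^bold>\<exists> \<^bold>\<diamond> Var 0 \<in> L"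
  shows "monadic_barcan_frame worlds lt E n"
proof unfold_locales
  fix x y z assume W: "x \<in> worlds" "y \<in> worlds" "z \<in> worlds" and "lt x y" "E y z"
  then obtain w where w: "w \<in> worlds" "E x w" "R w z"
    using E_barcan[OF assms W] by (auto simp: lt_def)
  \<comment> \<open>If w = z, then x and y are E-related through z, although y lies strictly above
    x.\<close>
  have "w \<noteq> z"
    using not_lt_E[OF W(1,2)] E_trans[OF W(1,3,2)] E_sym[OF W(2,3)] \<open>lt x y\<close> \<open>E y z\<close> w by blast
  then show "\<exists>w\<in>worlds. E x w \<and> lt w z"
    using w by (auto simp: lt_def)
qed

theorem theorem3p18:
  fixes n :: nat and \<phi> :: mform
  assumes "n \<ge> 1"
  shows "(\<phi> \<in> MplusGrz\<^bold>[n\<^bold>] \<longrightarrow> plus_translation \<phi> \<in> MGL\<^bold>[n\<^bold>])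
       \<and> (\<phi> \<in> MplusGrzB\<^bold>[n\<^bold>] \<longrightarrow> plus_translation \<phi> \<in> MGLB\<^bold>[n\<^bold>])
       \<and> (plus_translation \<phi> \<in> MGL\<^bold>[n\<^bold>] \<longrightarrow> \<phi> \<in> MplusGrz\<^bold>[n\<^bold>])
       \<and> (plus_translation \<phi> \<in> MGLB\<^bold>[n\<^bold>] \<longrightarrow> \<phi> \<in> MplusGrzB\<^bold>[n\<^bold>])"
proof (intro conjI impI)
  interpret MGL: gl_logic "MGL\<^bold>[n\<^bold>]" n
    by (rule gl_logic_MGL)
  show "plus_translation \<phi> \<in> MGL\<^bold>[n\<^bold>]" if "\<phi> \<in> MplusGrz\<^bold>[n\<^bold>]"
    by (rule MGL.plus_translation_mem) (rule subsetD[OF MGL.frame.MplusGrz_le that])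
next
  interpret MGLB: gl_logic "MGLB\<^bold>[n\<^bold>]" n
    by (rule gl_logic_MGLB)
  show "plus_translation \<phi> \<in> MGLB\<^bold>[n\<^bold>]" if "\<phi> \<in> MplusGrzB\<^bold>[n\<^bold>]"
    by (rule MGLB.plus_translation_mem)
      (rule subsetD[OF monadic_barcan_frame.MplusGrzB_le[OF MGLB.barcan_frame[OF barcan_mem(1)]] that])
next
  interpret MGrz: grz_logic "MplusGrz\<^bold>[n\<^bold>]" n
    by (rule grz_logic_MplusGrz)
  show "\<phi> \<in> MplusGrz\<^bold>[n\<^bold>]" if "plus_translation \<phi> \<in> MGL\<^bold>[n\<^bold>]"
    by (rule MGrz.mem_if_plus_translation) (rule subsetD[OF MGrz.frame.MGL_le that])
next
  interpret MGrzB: grz_logic "MplusGrzB\<^bold>[n\<^bold>]" n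
    by (rule grz_logic_MplusGrzB)
  show "\<phi> \<in> MplusGrzB\<^bold>[n\<^bold>]" if "plus_translation \<phi> \<in> MGLB\<^bold>[n\<^bold>]"
    by (rule MGrzB.mem_if_plus_translation)
      (rule subsetD[OF monadic_barcan_frame.MGLB_le[OF MGrzB.barcan_frame[OF barcan_mem(2)]] that])
qed

end
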